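(* For every positive integer $n$ with $n\neq 3$, the bar visibility number of the complete bipartite graph $K_{n,n}$ is $b(K_{n,n})=\left\lceil \frac{n+1}{4}\right\rceil$. Moreover, $b(K_{3,3})=2$.
   Context: A bar is a horizontal line segment in the plane. A $t$-bar visibility representation of a graph $G$ assigns to each vertex of $G$ at most $t$ pairwise disjoint bars so that two vertices are adjacent if and only if some bar assigned to one of them sees some bar assigned to the other, where two bars see each other if there is an axis-parallel rectangle of positive width whose bottom side lies in one bar and top side lies in the other and whose interior meets no other bar (an unobstructed vertical channel of positive width). The bar visibility number $b(G)$ is the least integer $t$ such that $G$ has a $t$-bar visibility representation. *)

theory Defs
  imports Complex_Main "Graph_Theory.Kuratowski"
begin

definition is_bar :: "(real \<times> real) set \<Rightarrow> bool" where
  "is_bar B \<longleftrightarrow> (\<exists>l r y. l < r \<and> B = {l..r} \<times> {y})"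

text \<open>
  \<open>\<B>\<close> is the set of all bars in the picture. A channel is a nondegenerate rectangle
  \<open>{a..b} \<times> {c..d}\<close> whose bottom side lies in one of the two bars and whose top side lies in
  the other.
\<close>

definition channel :: "(real \<times> real) set set \<Rightarrow> (real \<times> real) set \<Rightarrow> (real \<times> real) set \<Rightarrow> bool" where
  "channel \<B> B C \<longleftrightarrow>
     (\<exists>a b c d. a < b \<and> c < d \<and> {a..b} \<times> {c} \<subseteq> B \<and> {a..b} \<times> {d} \<subseteq> C \<and>
        (\<forall>D \<in> \<B> - {B, C}. ({a<..<b} \<times> {c<..<d}) \<inter> D = {}))"

definition sees :: "(real \<times> real) set set \<Rightarrow> (real \<times> real) set \<Rightarrow> (real \<times> real) set \<Rightarrow> bool" where
  "sees \<B> B C \<longleftrightarrow> channel \<B> B C \<or> channel \<B> C B"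

text \<open>
  Undirected graphs are symmetric digraphs (locale \<open>graph\<close>). All bars of a representation are
  pairwise disjoint, both those of one vertex and those of different vertices; the second
  condition also excludes using the same bar for two vertices. Bars of the same vertex may see
  each other, and every bar of the picture, whichever vertex it belongs to, blocks visibility.
\<close>

definition bar_visibility_rep ::
    "nat \<Rightarrow> ('a, 'b) pre_digraph \<Rightarrow> ('a \<Rightarrow> (real \<times> real) set set) \<Rightarrow> bool" where
  "bar_visibility_rep t G \<beta> \<longleftrightarrow>
     (\<forall>v \<in> verts G. finite (\<beta> v) \<and> card (\<beta> v) \<le> t \<and> (\<forall>B \<in> \<beta> v. is_bar B) \<and> pairwise disjnt (\<beta> v)) \<and>
     (\<forall>u \<in> verts G. \<forall>v \<in> verts G. u \<noteq> v \<longrightarrow> (\<forall>B \<in> \<beta> u. \<forall>C \<in> \<beta> v. disjnt B C)) \<and>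
     (\<forall>u \<in> verts G. \<forall>v \<in> verts G. u \<noteq> v \<longrightarrow>
        (u \<rightarrow>\<^bsub>G\<^esub> v \<longleftrightarrow> (\<exists>B \<in> \<beta> u. \<exists>C \<in> \<beta> v. sees (\<Union>w \<in> verts G. \<beta> w) B C)))"

definition bar_visibility_number :: "('a, 'b) pre_digraph \<Rightarrow> nat" where
  "bar_visibility_number G = (LEAST t. \<exists>\<beta>. bar_visibility_rep t G \<beta>)"

end

theory Submission
  imports Defs
begin

text \<open>
  Lower bound: sweep a vertical line from left to right. Consecutive bars on the line belong to the
  same vertex or to opposite sides of the bipartition. Let \<open>N\<close> be the number of bars started, \<open>E\<close> the
  number of vertex pairs seen and \<open>c\<close> the number of consecutive bars on opposite sides; then
  \<open>4 N - 2 E - c\<close> is at least 4 at the beginning and never decreases, so \<open>n\<^sup>2 \<le> 2 N - 2 < 4 n t\<close>. This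
  is not enough to exclude \<open>t = 1\<close> for \<open>n = 3\<close>, where a separate argument is needed: the bars of one
  side have a common x-interval, and two bars of the other side have to pass the middle one of
  them at the same end.

  Upper bound: write \<open>n = 4 s + h\<close> with \<open>h \<le> 3\<close>, that is, \<open>s\<close> blocks of four vertices on each side and
  \<open>h\<close> further vertices (hubs) on each side. The picture of a block shows 12 of the 16 edges inside the
  block, and each of its bars lies in a pair whose gap is filled by a strip of bars of vertices of the
  opposite side; half of the edges between two blocks is seen in the picture of one block, the other
  half in the picture of the other. The bars of index \<open>s\<close> form a frame that shows the missing four
  edges of each block and the remaining edges of the hubs; the last missing block edge is seen
  between the frame and the lowest bar of the block picture, which is placed on top of it.
\<close>

section \<open>Bars as triples\<close>

text \<open>Up to contracting sights between bars of one vertex, the bars form a bipartite planar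
  graph, which by Euler's formula has at most 2N - 4 edges if N \<ge> 3. The sweep is an elementary
  substitute that loses an additive 2. As N \<le> 2nt, the loss does not affect n^2 < 4nt; only for
  the nonplanar K_{3,3} is it felt, since n < 4t still admits t = 1 there. For n = 4t - 1 the
  inequality n^2 \<le> 2N - 2 leaves room for only n - 2 further sights, so the construction has to
  be nearly tight. This is why the frame serves several purposes at once and even the end of a strip
  is used for edges between hubs. Freedom comes from completeness: all vertices on opposite sides
  are adjacent, so repeated sights are harmless, and only distinct vertices of one side must not see
  each other. It is enough that in every column the bars alternate between the sides and that each
  edge occurs in some column. Both are local checks once every bar comes with the bar directly above
  it.\<close>

definition lf :: "real \<times> real \<times> real \<Rightarrow> real" where "lf p = fst p"
definition rt :: "real \<times> real \<times> real \<Rightarrow> real" where "rt p = fst (snd p)"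
definition ht :: "real \<times> real \<times> real \<Rightarrow> real" where "ht p = snd (snd p)"

definition hbar :: "real \<times> real \<times> real \<Rightarrow> (real \<times> real) set" where
  "hbar p = {lf p..rt p} \<times> {ht p}"

text \<open>The horizontal sides of a channel are forced to the heights of \<open>p\<close> and
  \<open>q\<close>, so only its horizontal extent is quantified.\<close>

definition chan :: "(real \<times> real \<times> real) set \<Rightarrow> real \<times> real \<times> real \<Rightarrow> real \<times> real \<times> real \<Rightarrow> bool" where
  "chan T p q \<longleftrightarrow> (\<exists>a b. a < b \<and> lf p \<le> a \<and> b \<le> rt p \<and> lf q \<le> a \<and> b \<le> rt q \<and> ht p < ht q \<and>
     (\<forall>k \<in> T - {p, q}. ht p < ht k \<and> ht k < ht q \<longrightarrow> rt k \<le> a \<or> b \<le> lf k))"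

lemma seg_eqI: "lf p = lf q \<Longrightarrow> rt p = rt q \<Longrightarrow> ht p = ht q \<Longrightarrow> p = q"
  by (simp add: lf_def rt_def ht_def prod_eq_iff)

lemma hbar_eq_iff:
  assumes "lf p < rt p"
  shows "hbar p = hbar q \<longleftrightarrow> p = q"
proof
  assume eq: "hbar p = hbar q"
  then have "lf q \<le> rt q" "ht p = ht q" "{lf p..rt p} = {lf q..rt q}"
    using eq assms unfolding hbar_def times_eq_iff by auto
  with assms show "p = q"
    by (intro seg_eqI) auto
qed simp

text \<open>The interior of the channel is open and the bar closed, so a bar that only touches a
  vertical side does not block; hence the weak inequalities.\<close>

lemma hbar_inter_empty:
  assumes "lf k < rt k" "a < b"
  shows "({a<..<b} \<times> {c<..<d}) \<inter> hbar k = {} \<longleftrightarrow> (c < ht k \<and> ht k < d \<longrightarrow> rt k \<le> a \<or> b \<le> lf k)"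
proof -
  have "{a<..<b} \<inter> {lf k..rt k} = {} \<longleftrightarrow> rt k \<le> a \<or> b \<le> lf k"
  proof
    assume e: "{a<..<b} \<inter> {lf k..rt k} = {}"
    show "rt k \<le> a \<or> b \<le> lf k"
    proof (rule ccontr)
      assume "\<not> (rt k \<le> a \<or> b \<le> lf k)"
      then have lt: "max a (lf k) < min b (rt k)" using assms by auto
      then obtain x where "max a (lf k) < x" "x < min b (rt k)" using dense by blast
      then have "x \<in> {a<..<b} \<inter> {lf k..rt k}" by auto
      with e show False by blast
    qed
  qed (use assms in auto)
  then show ?thesis
    by (auto simp: hbar_def Times_Int_Times)
qed

lemma channel_hbar:
  assumes T: "\<And>k. k \<in> T \<Longrightarrow> lf k < rt k" and p: "p \<in> T" and q: "q \<in> T"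
  shows "channel (hbar ` T) (hbar p) (hbar q) \<longleftrightarrow> chan T p q"
proof -
  have D: "hbar ` T - {hbar p, hbar q} = hbar ` (T - {p, q})"
    using hbar_eq_iff[OF T] p q by blast
  have sub: "{a..b} \<times> {c} \<subseteq> hbar k \<longleftrightarrow> lf k \<le> a \<and> b \<le> rt k \<and> c = ht k" if "a < b" for a b c k
    using that by (auto simp: hbar_def subset_iff)
  have blk: "(\<forall>D \<in> hbar ` (T - {p, q}). ({a<..<b} \<times> {c<..<d}) \<inter> D = {}) \<longleftrightarrow>
      (\<forall>k \<in> T - {p, q}. c < ht k \<and> ht k < d \<longrightarrow> rt k \<le> a \<or> b \<le> lf k)" if "a < b" for a b c d
    unfolding ball_simps by (rule ball_cong) (use hbar_inter_empty[OF T that] in auto)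
  show ?thesis
  proof
    assume "channel (hbar ` T) (hbar p) (hbar q)"
    then obtain a b c d where *: "a < b" "c < d" "{a..b} \<times> {c} \<subseteq> hbar p" "{a..b} \<times> {d} \<subseteq> hbar q"
      "\<forall>D \<in> hbar ` (T - {p, q}). ({a<..<b} \<times> {c<..<d}) \<inter> D = {}"
      unfolding channel_def D by (elim exE conjE) (rule that)
    show "chan T p q"
      unfolding chan_def
    proof (intro exI conjI)
      show "a < b" by fact
      show "lf p \<le> a" "b \<le> rt p" "lf q \<le> a" "b \<le> rt q" "ht p < ht q"
        using * sub[OF *(1)] by simp_all
      show "\<forall>k \<in> T - {p, q}. ht p < ht k \<and> ht k < ht q \<longrightarrow> rt k \<le> a \<or> b \<le> lf k"
        using *(2-5) sub[OF *(1)] blk[OF *(1)] by metis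
    qed
  next
    assume "chan T p q"
    then obtain a b where *: "a < b" "lf p \<le> a" "b \<le> rt p" "lf q \<le> a" "b \<le> rt q" "ht p < ht q"
      "\<forall>k \<in> T - {p, q}. ht p < ht k \<and> ht k < ht q \<longrightarrow> rt k \<le> a \<or> b \<le> lf k"
      unfolding chan_def by (elim exE conjE) (rule that)
    show "channel (hbar ` T) (hbar p) (hbar q)"
      unfolding channel_def D
    proof (intro exI conjI)
      show "a < b" by fact
      show "ht p < ht q" by fact
      show "{a..b} \<times> {ht p} \<subseteq> hbar p" "{a..b} \<times> {ht q} \<subseteq> hbar q"
        using * sub[OF *(1)] by simp_all
      show "\<forall>D \<in> hbar ` (T - {p, q}). ({a<..<b} \<times> {ht p<..<ht q}) \<inter> D = {}"
        using blk[OF *(1)] *(7) by metis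
    qed
  qed
qed

lemma sees_hbar:
  assumes "\<And>k. k \<in> T \<Longrightarrow> lf k < rt k" "p \<in> T" "q \<in> T"
  shows "sees (hbar ` T) (hbar p) (hbar q) \<longleftrightarrow> chan T p q \<or> chan T q p"
  unfolding sees_def using channel_hbar[OF assms(1)] assms(2,3) by blast

lemma disjnt_hbar:
  assumes "lf p < rt p" "lf q < rt q"
  shows "disjnt (hbar p) (hbar q) \<longleftrightarrow> (ht p = ht q \<longrightarrow> rt p < lf q \<or> rt q < lf p)"
proof
  assume d: "disjnt (hbar p) (hbar q)"
  show "ht p = ht q \<longrightarrow> rt p < lf q \<or> rt q < lf p"
  proof (intro impI, rule ccontr)
    assume "ht p = ht q" "\<not> (rt p < lf q \<or> rt q < lf p)"
    then have "(max (lf p) (lf q), ht p) \<in> hbar p \<inter> hbar q" using assms by (auto simp: hbar_def)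
    with d show False by (auto simp: disjnt_def)
  qed
qed (auto simp: disjnt_def hbar_def)

lemma is_bar_hbar: "is_bar B \<longleftrightarrow> (\<exists>p. lf p < rt p \<and> B = hbar p)"
  unfolding is_bar_def hbar_def lf_def rt_def ht_def by auto

section \<open>The lower bound by a sweep\<close>

text \<open>A list is one column of the sweep from bottom to top, and \<open>f\<close> gives the
  side and the vertex of a bar. \<open>npairs\<close> counts positions whereas \<open>pairs\<close>
  collects edges, so an edge seen twice in a column is counted twice only by
  \<open>npairs\<close>.\<close>

fun npairs :: "('i \<Rightarrow> bool \<times> 'v) \<Rightarrow> 'i list \<Rightarrow> nat" where
  "npairs f (x # y # zs) = (if fst (f x) \<noteq> fst (f y) then 1 else 0) + npairs f (y # zs)"
| "npairs f _ = 0"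

fun pairs :: "('i \<Rightarrow> bool \<times> 'v) \<Rightarrow> 'i list \<Rightarrow> (bool \<times> 'v) set set" where
  "pairs f (x # y # zs) = (if fst (f x) \<noteq> fst (f y) then {{f x, f y}} else {}) \<union> pairs f (y # zs)"
| "pairs f _ = {}"

fun proper :: "('i \<Rightarrow> bool \<times> 'v) \<Rightarrow> 'i list \<Rightarrow> bool" where
  "proper f (x # y # zs) \<longleftrightarrow> (f x = f y \<or> fst (f x) \<noteq> fst (f y)) \<and> proper f (y # zs)"
| "proper f _ \<longleftrightarrow> True"

lemma finite_pairs [simp]: "finite (pairs f xs)"
  by (induction f xs rule: pairs.induct) auto

lemma card_pairs_le: "card (pairs f xs) \<le> npairs f xs"
proof (induction f xs rule: pairs.induct)
  case (1 f x y zs)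
  then show ?case by (auto simp: card_insert_if)
qed auto

lemma npairs_le: "npairs f xs \<le> length xs - 1"
  by (induction f xs rule: npairs.induct) auto

lemma npairs_append: "npairs f (xs @ z # ys) = npairs f (xs @ [z]) + npairs f (z # ys)"
proof (induction xs)
  case (Cons x xs)
  then show ?case by (cases xs) auto
qed simp

lemma pairs_append: "pairs f (xs @ z # ys) = pairs f (xs @ [z]) \<union> pairs f (z # ys)"
proof (induction xs)
  case (Cons x xs)
  then show ?case by (cases xs) auto
qed simp

lemma proper_append: "proper f (xs @ z # ys) \<longleftrightarrow> proper f (xs @ [z]) \<and> proper f (z # ys)"
proof (induction xs)
  case (Cons x xs)
  then show ?case by (cases xs) auto
qed simp

lemma even_npairs: "even (npairs f (z # xs)) \<longleftrightarrow> fst (f z) = fst (f (last (z # xs)))"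
proof (induction xs arbitrary: z)
  case (Cons x xs)
  from Cons[of x] show ?case by auto
qed simp

lemma npairs_0_imp: "proper f (z # xs) \<Longrightarrow> npairs f (z # xs) = 0 \<Longrightarrow> f (last (z # xs)) = f z"
proof (induction xs arbitrary: z)
  case (Cons x xs)
  from Cons.prems have "f x = f z" by (simp split: if_splits)
  moreover from Cons.prems have "f (last (x # xs)) = f x" by (intro Cons.IH) simp_all
  ultimately show ?case by (metis last_ConsR list.distinct(1))
qed simp

text \<open>Below and above the single change of side the label is constant, so the edge seen at the
  change joins the two end labels.\<close>

lemma npairs_1_imp:
  "proper f (z # xs) \<Longrightarrow> npairs f (z # xs) = 1 \<Longrightarrow> {f z, f (last (z # xs))} \<in> pairs f (z # xs)"
proof (induction xs arbitrary: z)
  case (Cons x xs)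
  have l: "last (z # x # xs) = last (x # xs)" by simp
  show ?case
  proof (cases "fst (f z) = fst (f x)")
    case True
    with Cons.prems have "f z = f x" "proper f (x # xs)" "npairs f (x # xs) = 1" by auto
    with Cons.IH[of x] show ?thesis unfolding l by simp
  next
    case False
    with Cons.prems have "proper f (x # xs)" "npairs f (x # xs) = 0" by auto
    from npairs_0_imp[OF this] False show ?thesis unfolding l by (simp del: last.simps)
  qed
qed simp

text \<open>Each opposite position counts once itself and brings at most one new edge of weight 2,
  so \<open>3 * k\<close> already suffices. This settles every stretch of a column that is not
  enclosed by two persisting bars.\<close>

lemma new_pairs_end:
  assumes "npairs f ys \<le> k"
  shows "2 * card (pairs f ys - X) + npairs f ys \<le> 4 * k + a"
proof -
  have "card (pairs f ys - X) \<le> card (pairs f ys)" by (simp add: card_mono)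
  with card_pairs_le[of f ys] assms show ?thesis by linarith
qed

text \<open>
  \<open>D\<close> ends and \<open>B\<close> starts between the persisting bars \<open>z\<close> and \<open>w\<close>. The two numbers of consecutive opposite
  bars have the same parity, which leaves only few cases that need the labels.
\<close>

lemma new_pairs_gap:
  assumes "proper f (z # D @ [w])" "proper f (z # B @ [w])"
  shows "2 * card (pairs f (z # B @ [w]) - pairs f (z # D @ [w])) + npairs f (z # B @ [w])
       \<le> 4 * length B + npairs f (z # D @ [w])"
proof -
  let ?b = "npairs f (z # B @ [w])" and ?a = "npairs f (z # D @ [w])"
  let ?N = "pairs f (z # B @ [w]) - pairs f (z # D @ [w])"
  have N: "card ?N \<le> card (pairs f (z # B @ [w]))" by (simp add: card_mono)
  have b: "?b \<le> length B + 1" using npairs_le[of f "z # B @ [w]"] by simp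
  have par: "even ?a \<longleftrightarrow> even ?b"
    using even_npairs[of f z "B @ [w]"] even_npairs[of f z "D @ [w]"] by simp
  \<comment> \<open>A weight of 3 for each of \<open>length B + 1\<close> positions can exceed the
    bound only if \<open>length B + ?a\<close> is below 3.\<close>
  consider "?b \<le> length B" | "?b = length B + 1" "length B + ?a \<ge> 3"
    | "?b = length B + 1" "length B = 0" "?a \<le> 2" | "?b = length B + 1" "length B = 1" "?a \<le> 1"
    | "?b = length B + 1" "length B = 2" "?a = 0"
    using b by linarith
  then show ?thesis
  proof cases
    case 1
    then show ?thesis by (rule new_pairs_end)
  next
    case 2
    then show ?thesis using N card_pairs_le[of f "z # B @ [w]"] by linarith
  next
    case 3
    have "odd a \<Longrightarrow> a \<le> 2 \<Longrightarrow> a = 1" for a :: nat by presburger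
    moreover have "odd ?a" using par 3(1,2) by simp
    ultimately have a: "?a = 1" using 3(3) by blast
    from 3 have B: "B = []" by simp
    \<comment> \<open>The edge between \<open>z\<close> and \<open>w\<close> was already seen in the
      old column, at the single change of side between them.\<close>
    from npairs_1_imp[of f z "D @ [w]"] a assms have "{f z, f w} \<in> pairs f (z # D @ [w])" by simp
    then have "?N = {}" using B by auto
    then show ?thesis using a 3 by (simp only: card.empty)
  next
    case 4
    have "even a \<Longrightarrow> a \<le> 1 \<Longrightarrow> a = 0" for a :: nat by presburger
    moreover have "even ?a" using par 4(1,2) by simp
    ultimately have a: "?a = 0" using 4(3) by blast
    \<comment> \<open>\<open>z\<close> and \<open>w\<close> belong to one vertex, so the new bar
      shows the same edge below and above.\<close>
    from npairs_0_imp[OF assms(1) a] have zw: "f w = f z" by simp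
    obtain x where "B = [x]" using 4 by (cases B) auto
    with zw have "pairs f (z # B @ [w]) \<subseteq> {{f z, f x}}" by (auto simp: insert_commute)
    then have "card (pairs f (z # B @ [w])) \<le> card {{f z, f x}}" by (intro card_mono) auto
    then have "card (pairs f (z # B @ [w])) \<le> 1" by simp
    then show ?thesis using N a 4 by linarith
  next
    case 5
    then have "?b = 3" by simp
    with par 5(3) have False by (simp only:) simp
    then show ?thesis ..
  qed
qed

text \<open>Bars keep their vertical order while they persist, which the \<open>filter\<close>
  equation expresses; hence both lists have the same lowest common bar and can be cut there.\<close>

lemma split_at_common:
  assumes "distinct ys" and flt: "filter (\<lambda>x. x \<in> set ys) xs = filter (\<lambda>x. x \<in> set xs) ys"
    and "set xs \<inter> set ys \<noteq> {}"
  obtains D B w xs' ys' where "xs = D @ w # xs'" "ys = B @ w # ys'" "distinct ys'"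
    "filter (\<lambda>x. x \<in> set ys') xs' = filter (\<lambda>x. x \<in> set xs') ys'"
    "card (set ys - set xs) = length B + card (set ys' - set xs')"
proof -
  from assms(3) obtain B w ys' where ys: "ys = B @ w # ys'" and w: "w \<in> set xs" and B: "\<forall>b\<in>set B. b \<notin> set xs"
    using split_list_first_prop[of ys "\<lambda>x. x \<in> set xs"] by blast
  from assms(3) obtain D w' xs' where xs: "xs = D @ w' # xs'" and w': "w' \<in> set ys" and D: "\<forall>b\<in>set D. b \<notin> set ys"
    using split_list_first_prop[of xs "\<lambda>x. x \<in> set ys"] by blast
  have fB: "filter (\<lambda>x. x \<in> set xs) B = []" using B by (simp add: filter_empty_conv)
  have fD: "filter (\<lambda>x. x \<in> set ys) D = []" using D by (simp add: filter_empty_conv)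
  have "filter (\<lambda>x. x \<in> set ys) xs = w' # filter (\<lambda>x. x \<in> set ys) xs'"
    using fD w' by (subst xs) simp
  moreover have "filter (\<lambda>x. x \<in> set xs) ys = w # filter (\<lambda>x. x \<in> set xs) ys'"
    using fB w by (subst ys) simp
  ultimately have ww: "w' = w" and fe: "filter (\<lambda>x. x \<in> set ys) xs' = filter (\<lambda>x. x \<in> set xs) ys'"
    using flt by auto
  have dy: "distinct ys'" "w \<notin> set ys'" "set B \<inter> set ys' = {}" "w \<notin> set B" "distinct B"
    using assms(1) ys by auto
  have wx: "w \<notin> set xs'"
  proof
    assume "w \<in> set xs'"
    then have "w \<in> set (filter (\<lambda>x. x \<in> set ys) xs')" using ys by simp
    with fe dy show False by simp
  qed
  have f1: "filter (\<lambda>x. x \<in> set ys') xs' = filter (\<lambda>x. x \<in> set ys) xs'"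
  proof (rule filter_cong[OF refl])
    fix x assume "x \<in> set xs'"
    then show "x \<in> set ys' \<longleftrightarrow> x \<in> set ys" using ys wx B xs by auto
  qed
  have f2: "filter (\<lambda>x. x \<in> set xs') ys' = filter (\<lambda>x. x \<in> set xs) ys'"
  proof (rule filter_cong[OF refl])
    fix x assume "x \<in> set ys'"
    then show "x \<in> set xs' \<longleftrightarrow> x \<in> set xs" using xs dy D ys ww by auto
  qed
  have "set ys - set xs = set B \<union> (set ys' - set xs')"
    using ys xs ww B dy D by auto
  moreover have "card (set B \<union> (set ys' - set xs')) = card (set B) + card (set ys' - set xs')"
    using dy by (intro card_Un_disjoint) auto
  ultimately have "card (set ys - set xs) = length B + card (set ys' - set xs')"
    using dy by (simp add: distinct_card)
  with that[of D w xs' B ys'] xs ys ww dy(1) f1 f2 fe show ?thesis by simp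
qed

lemma card_diff_Un_le:
  assumes "finite A" "finite C"
  shows "card ((A \<union> C) - (B \<union> E)) \<le> card (A - B) + card (C - E)"
proof -
  have "card ((A \<union> C) - (B \<union> E)) \<le> card ((A - B) \<union> (C - E))"
    using assms by (intro card_mono) auto
  also have "\<dots> \<le> card (A - B) + card (C - E)" by (rule card_Un_le)
  finally show ?thesis .
qed

lemma new_pairs_disjoint:
  assumes "distinct ys" "set xs \<inter> set ys = {}" "npairs f zs \<le> length ys"
  shows "2 * card (pairs f zs - X) + npairs f zs \<le> 4 * card (set ys - set xs) + a"
proof -
  have "set ys - set xs = set ys" using assms(2) by blast
  then have "card (set ys - set xs) = length ys" using assms(1) by (simp add: distinct_card)
  then show ?thesis using new_pairs_end[OF assms(3)] by simp
qed

text \<open>Cutting both columns at their common bars leaves gaps, each paid for by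
  \<open>new_pairs_gap\<close>, and an open top end, where each new bar brings at most one opposite
  position.\<close>

lemma new_pairs_from_common:
  assumes "proper f (z # xs)" "proper f (z # ys)" "distinct ys"
    and "filter (\<lambda>x. x \<in> set ys) xs = filter (\<lambda>x. x \<in> set xs) ys"
  shows "2 * card (pairs f (z # ys) - pairs f (z # xs)) + npairs f (z # ys)
       \<le> 4 * card (set ys - set xs) + npairs f (z # xs)"
  using assms
proof (induction "length ys" arbitrary: z xs ys rule: less_induct)
  case less
  show ?case
  proof (cases "set xs \<inter> set ys = {}")
    case True
    then show ?thesis
      using npairs_le[of f "z # ys"] less.prems by (intro new_pairs_disjoint) auto
  next
    case False
    obtain D B w xs' ys' where split: "xs = D @ w # xs'" "ys = B @ w # ys'" "distinct ys'"
      "filter (\<lambda>x. x \<in> set ys') xs' = filter (\<lambda>x. x \<in> set xs') ys'"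
      and card: "card (set ys - set xs) = length B + card (set ys' - set xs')"
      by (rule split_at_common[OF less.prems(3,4) False])
    have px: "proper f (z # D @ [w])" "proper f (w # xs')"
      using less.prems(1) proper_append[of f "z # D" w xs'] split by auto
    have py: "proper f (z # B @ [w])" "proper f (w # ys')"
      using less.prems(2) proper_append[of f "z # B" w ys'] split by auto
    have IH: "2 * card (pairs f (w # ys') - pairs f (w # xs')) + npairs f (w # ys')
       \<le> 4 * card (set ys' - set xs') + npairs f (w # xs')"
      using split px py by (intro less.hyps) auto
    have gap: "2 * card (pairs f (z # B @ [w]) - pairs f (z # D @ [w])) + npairs f (z # B @ [w])
       \<le> 4 * length B + npairs f (z # D @ [w])"
      using px py by (intro new_pairs_gap)
    have P: "pairs f (z # ys) = pairs f (z # B @ [w]) \<union> pairs f (w # ys')"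
      "pairs f (z # xs) = pairs f (z # D @ [w]) \<union> pairs f (w # xs')"
      using pairs_append[of f "z # B" w ys'] pairs_append[of f "z # D" w xs'] split by auto
    have c: "card (pairs f (z # ys) - pairs f (z # xs))
      \<le> card (pairs f (z # B @ [w]) - pairs f (z # D @ [w])) + card (pairs f (w # ys') - pairs f (w # xs'))"
      unfolding P by (rule card_diff_Un_le) auto
    have n: "npairs f (z # ys) = npairs f (z # B @ [w]) + npairs f (w # ys')"
      "npairs f (z # xs) = npairs f (z # D @ [w]) + npairs f (w # xs')"
      using npairs_append[of f "z # B" w ys'] npairs_append[of f "z # D" w xs'] split by auto
    show ?thesis using IH gap c n card by linarith
  qed
qed

text \<open>Below the lowest common bar nothing persists, so the new bars there bring at most
  \<open>length B\<close> opposite positions; above it \<open>new_pairs_from_common\<close>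
  applies.\<close>

lemma new_pairs_step:
  assumes "proper f xs" "proper f ys" "distinct ys"
    and "filter (\<lambda>x. x \<in> set ys) xs = filter (\<lambda>x. x \<in> set xs) ys"
  shows "2 * card (pairs f ys - pairs f xs) + npairs f ys \<le> 4 * card (set ys - set xs) + npairs f xs"
proof (cases "set xs \<inter> set ys = {}")
  case True
  then show ?thesis
    using npairs_le[of f ys] assms by (intro new_pairs_disjoint) auto
next
  case False
  obtain D B w xs' ys' where split: "xs = D @ w # xs'" "ys = B @ w # ys'" "distinct ys'"
    "filter (\<lambda>x. x \<in> set ys') xs' = filter (\<lambda>x. x \<in> set xs') ys'"
    and card: "card (set ys - set xs) = length B + card (set ys' - set xs')"
    by (rule split_at_common[OF assms(3,4) False])
  have p: "proper f (w # xs')" "proper f (w # ys')"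
    using assms(1,2) proper_append[of f D w xs'] proper_append[of f B w ys'] split by auto
  have IH: "2 * card (pairs f (w # ys') - pairs f (w # xs')) + npairs f (w # ys')
     \<le> 4 * card (set ys' - set xs') + npairs f (w # xs')"
    using split p by (intro new_pairs_from_common)
  have B: "2 * card (pairs f (B @ [w]) - pairs f (D @ [w])) + npairs f (B @ [w])
     \<le> 4 * length B + npairs f (D @ [w])"
    using npairs_le[of f "B @ [w]"] by (intro new_pairs_end) simp
  have P: "pairs f ys = pairs f (B @ [w]) \<union> pairs f (w # ys')" "pairs f xs = pairs f (D @ [w]) \<union> pairs f (w # xs')"
    using pairs_append[of f B w ys'] pairs_append[of f D w xs'] split by auto
  have c: "card (pairs f ys - pairs f xs)
    \<le> card (pairs f (B @ [w]) - pairs f (D @ [w])) + card (pairs f (w # ys') - pairs f (w # xs'))"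
    unfolding P by (rule card_diff_Un_le) auto
  have n: "npairs f ys = npairs f (B @ [w]) + npairs f (w # ys')" "npairs f xs = npairs f (D @ [w]) + npairs f (w # xs')"
    using npairs_append[of f B w ys'] npairs_append[of f D w xs'] split by auto
  show ?thesis using IH B c n card by linarith
qed

text \<open>The potential \<open>4 * #started - 2 * #seen - npairs\<close> never decreases along the sweep and is at
  least 4 after the first column.\<close>

lemma sweep_bound:
  assumes proper: "\<And>i. i \<le> m \<Longrightarrow> proper f (L i)" and dist: "\<And>i. i \<le> m \<Longrightarrow> distinct (L i)"
    and flt: "\<And>i. i < m \<Longrightarrow> filter (\<lambda>x. x \<in> set (L (Suc i))) (L i) = filter (\<lambda>x. x \<in> set (L i)) (L (Suc i))"
    and contig: "\<And>i j k x. i \<le> j \<Longrightarrow> j \<le> k \<Longrightarrow> k \<le> m \<Longrightarrow> x \<in> set (L i) \<Longrightarrow> x \<in> set (L k) \<Longrightarrow> x \<in> set (L j)"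
    and ne: "L 0 \<noteq> []"
  shows "2 * card (\<Union>i\<le>m. pairs f (L i)) + npairs f (L m) + 4 \<le> 4 * card (\<Union>i\<le>m. set (L i))"
  using proper dist flt contig
proof (induction m)
  case 0
  \<comment> \<open>With N bars in the first column both counts are at most N - 1, which leaves a
    potential of at least 4N - 3(N - 1) = N + 3.\<close>
  have "card (set (L 0)) = length (L 0)" "length (L 0) \<ge> 1"
    using 0(2)[of 0] ne by (auto simp: distinct_card Suc_le_eq)
  then show ?case using card_pairs_le[of f "L 0"] npairs_le[of f "L 0"] by simp
next
  case (Suc m)
  have IH: "2 * card (\<Union>i\<le>m. pairs f (L i)) + npairs f (L m) + 4 \<le> 4 * card (\<Union>i\<le>m. set (L i))"
  proof (rule Suc.IH)
    show "x \<in> set (L j)" if "i \<le> j" "j \<le> k" "k \<le> m" "x \<in> set (L i)" "x \<in> set (L k)" for i j k x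
      using Suc.prems(4)[of i j k x] that by simp
  qed (use Suc.prems(1-3) in auto)
  have step: "2 * card (pairs f (L (Suc m)) - pairs f (L m)) + npairs f (L (Suc m))
      \<le> 4 * card (set (L (Suc m)) - set (L m)) + npairs f (L m)"
    by (rule new_pairs_step) (use Suc.prems in auto)
  have "(\<Union>i\<le>Suc m. pairs f (L i)) = (\<Union>i\<le>m. pairs f (L i)) \<union> (pairs f (L (Suc m)) - pairs f (L m))"
    unfolding atMost_Suc by blast
  then have a: "card (\<Union>i\<le>Suc m. pairs f (L i))
      \<le> card (\<Union>i\<le>m. pairs f (L i)) + card (pairs f (L (Suc m)) - pairs f (L m))"
    by (simp only: card_Un_le)
  have "(\<Union>i\<le>Suc m. set (L i)) = (\<Union>i\<le>m. set (L i)) \<union> (set (L (Suc m)) - set (L m))"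
    unfolding atMost_Suc by blast
  \<comment> \<open>A bar that starts now cannot have occurred before, because it occupies an
    interval of columns.\<close>
  moreover have "(\<Union>i\<le>m. set (L i)) \<inter> (set (L (Suc m)) - set (L m)) = {}"
    using Suc.prems(4)[of _ m "Suc m"] by auto
  ultimately have b: "card (\<Union>i\<le>Suc m. set (L i))
      = card (\<Union>i\<le>m. set (L i)) + card (set (L (Suc m)) - set (L m))"
    by (simp add: card_Un_disjoint)
  show ?case using IH step a b by linarith
qed

section \<open>Columns of a finite set of bars\<close>

lemma ex_sorted_wrt_key:
  fixes h :: "'i \<Rightarrow> real"
  assumes "finite X" "inj_on h X"
  shows "\<exists>xs. set xs = X \<and> sorted_wrt (\<lambda>a b. h a < h b) xs"
proof (intro exI conjI)
  let ?xs = "map (the_inv_into X h) (sorted_list_of_set (h ` X))"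
  show "set ?xs = X"
    using assms by (force simp: the_inv_into_f_f)
  have "sorted_wrt (<) (sorted_list_of_set (h ` X))" by simp
  moreover have "set (sorted_list_of_set (h ` X)) = h ` X" using assms by simp
  ultimately have "sorted_wrt (\<lambda>a b. h (the_inv_into X h a) < h (the_inv_into X h b)) (sorted_list_of_set (h ` X))"
    using assms by (elim sorted_wrt_mono_rel[rotated]) (auto simp: the_inv_into_f_f)
  then show "sorted_wrt (\<lambda>a b. h a < h b) ?xs" by (simp add: sorted_wrt_map)
qed

lemma sorted_wrt_key_unique:
  fixes h :: "'i \<Rightarrow> real"
  assumes "sorted_wrt (\<lambda>a b. h a < h b) xs" "sorted_wrt (\<lambda>a b. h a < h b) ys" "set xs = set ys" "inj_on h (set xs)"
  shows "xs = ys"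
proof -
  have "map h xs = map h ys"
    using assms by (intro strict_sorted_equal) (auto simp: sorted_wrt_map)
  then show ?thesis using assms by (intro map_inj_on[of h]) auto
qed

lemma sorted_wrt_key_consecutive:
  fixes h :: "'i \<Rightarrow> real"
  assumes "sorted_wrt (\<lambda>a b. h a < h b) xs" "p \<in> set xs" "q \<in> set xs" "h p < h q"
    and "\<And>k. k \<in> set xs \<Longrightarrow> \<not> (h p < h k \<and> h k < h q)"
  shows "\<exists>as bs. xs = as @ p # q # bs"
proof -
  obtain as cs where xs: "xs = as @ p # cs" using assms(2) by (meson split_list)
  have "q \<notin> set as" using assms(1,4) unfolding xs by (force simp: sorted_wrt_append)
  then have q: "q \<in> set cs" using assms(3,4) xs by auto
  then obtain c bs where cs: "cs = c # bs" by (cases cs) auto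
  have "c = q"
  proof (rule ccontr)
    assume "c \<noteq> q"
    then have "q \<in> set bs" using q cs by auto
    then have "h p < h c" "h c < h q" using assms(1) unfolding xs cs by (auto simp: sorted_wrt_append)
    then show False using assms(5)[of c] unfolding xs cs by auto
  qed
  then show ?thesis using xs cs by blast
qed

lemma properI:
  assumes "\<And>as x y bs. xs = as @ x # y # bs \<Longrightarrow> f x = f y \<or> fst (f x) \<noteq> fst (f y)"
  shows "proper f xs"
  using assms
proof (induction f xs rule: proper.induct)
  case (1 f x y zs)
  have "proper f (y # zs)"
  proof (rule "1.IH")
    show "f u = f v \<or> fst (f u) \<noteq> fst (f v)" if "y # zs = as @ u # v # bs" for as u v bs
      using "1.prems"[of "x # as" u v bs] that by simp
  qed
  then show ?case using "1.prems"[of "[]" x y zs] by simp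
qed auto

lemma in_pairsI: "fst (f p) \<noteq> fst (f q) \<Longrightarrow> {f p, f q} \<in> pairs f (as @ p # q # bs)"
  by (subst pairs_append) simp

text \<open>Between consecutive endpoints of bars the set of bars met by a vertical line is
  constant. These elementary intervals are the columns of the sweep, and neighbours in a column see
  each other across the whole interval.\<close>

lemma bar_config_bound:
  fixes lab :: "real \<times> real \<times> real \<Rightarrow> bool \<times> 'v"
  assumes fin: "finite T" and ne: "T \<noteq> {}" and pos: "\<And>k. k \<in> T \<Longrightarrow> lf k < rt k"
    and disj: "\<And>i j. i \<in> T \<Longrightarrow> j \<in> T \<Longrightarrow> i \<noteq> j \<Longrightarrow> ht i = ht j \<Longrightarrow> rt i < lf j \<or> rt j < lf i"
    and opp: "\<And>p q. p \<in> T \<Longrightarrow> q \<in> T \<Longrightarrow> chan T p q \<Longrightarrow> lab p = lab q \<or> fst (lab p) \<noteq> fst (lab q)"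
    and E: "\<And>e. e \<in> E \<Longrightarrow> \<exists>p\<in>T. \<exists>q\<in>T. e = {lab p, lab q} \<and> fst (lab p) \<noteq> fst (lab q) \<and> chan T p q"
  shows "card E + 2 \<le> 2 * card T"
proof -
  define P where "P = lf ` T \<union> rt ` T"
  define es where "es = sorted_list_of_set P"
  have finP: "finite P" using fin by (simp add: P_def)
  have ses: "sorted_wrt (<) es" and setes: "set es = P" using finP by (auto simp: es_def)
  have mono: "es ! i < es ! j" if "i < j" "j < length es" for i j
    using ses that by (simp add: sorted_wrt_iff_nth_less)
  have mono': "es ! i \<le> es ! j" if "i \<le> j" "j < length es" for i j
    using mono[of i j] that by (cases "i = j") auto
  obtain k0 where k0: "k0 \<in> T" using ne by blast
  have "card {lf k0, rt k0} \<le> card P" using k0 finP by (intro card_mono) (auto simp: P_def)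
  then have len: "length es \<ge> 2" using pos[OF k0] by (simp add: es_def)
  \<comment> \<open>There are \<open>length es - 1\<close> elementary intervals, indexed from 0 to
    \<open>m\<close>.\<close>
  define m where "m = length es - 2"
  have m: "Suc i < length es" if "i \<le> m" for i using that len by (simp add: m_def)
  have gap: "x \<le> es ! i \<or> es ! Suc i \<le> x" if "x \<in> P" "i \<le> m" for x i
  proof -
    from that setes obtain j where "j < length es" "x = es ! j" by (metis in_set_conv_nth)
    then show ?thesis using mono'[of j i] mono'[of "Suc i" j] m[OF that(2)] by (cases "j \<le> i") auto
  qed
  define Col where "Col i = {k \<in> T. lf k \<le> es ! i \<and> es ! Suc i \<le> rt k}" for i
  have ends: "lf k \<in> P" "rt k \<in> P" if "k \<in> T" for k using that by (auto simp: P_def)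
  have inj: "inj_on ht (Col i)" if "i \<le> m" for i
  proof (rule inj_onI, rule ccontr)
    fix x y assume *: "x \<in> Col i" "y \<in> Col i" "ht x = ht y" "x \<noteq> y"
    then have "rt x < lf y \<or> rt y < lf x" by (intro disj) (auto simp: Col_def)
    moreover have "es ! i < es ! Suc i" using mono m that by simp
    ultimately show False using * by (auto simp: Col_def)
  qed
  have "\<exists>xs. i \<le> m \<longrightarrow> set xs = Col i \<and> sorted_wrt (\<lambda>a b. ht a < ht b) xs" for i
    using ex_sorted_wrt_key[of "Col i" ht] inj fin by (auto simp: Col_def)
  then obtain L where "\<And>i. i \<le> m \<longrightarrow> set (L i) = Col i \<and> sorted_wrt (\<lambda>a b. ht a < ht b) (L i)"
    by metis
  then have setL: "\<And>i. i \<le> m \<Longrightarrow> set (L i) = Col i"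
    and sL: "\<And>i. i \<le> m \<Longrightarrow> sorted_wrt (\<lambda>a b. ht a < ht b) (L i)" by auto
  have chanL: "chan T x y" if i: "i \<le> m" and L: "L i = as @ x # y # bs" for i as x y bs
  proof -
    have xy: "x \<in> Col i" "y \<in> Col i" using setL[OF i] L by auto
    have "rt k \<le> es ! i \<or> es ! Suc i \<le> lf k" if k: "k \<in> T - {x, y}" "ht x < ht k" "ht k < ht y" for k
    proof (rule ccontr)
      assume "\<not> ?thesis"
      then have "k \<in> Col i" using gap[OF ends(1) i, of k] gap[OF ends(2) i, of k] k by (auto simp: Col_def)
      then have "k \<in> set (as @ x # y # bs)" using setL[OF i] L by simp
      then show False using sL[OF i] k unfolding L by (auto simp: sorted_wrt_append)
    qed
    then show ?thesis
      unfolding chan_def using xy mono[OF _ m[OF i]] sL[OF i] L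
      by (intro exI[of _ "es ! i"] exI[of _ "es ! Suc i"]) (auto simp: Col_def sorted_wrt_append)
  qed
  have "2 * card (\<Union>i\<le>m. pairs lab (L i)) + npairs lab (L m) + 4 \<le> 4 * card (\<Union>i\<le>m. set (L i))"
  proof (rule sweep_bound)
    fix i assume i: "i \<le> m"
    show "proper lab (L i)"
    proof (rule properI)
      fix as x y bs assume L: "L i = as @ x # y # bs"
      then have "x \<in> T" "y \<in> T" using setL[OF i] by (auto simp: Col_def)
      then show "lab x = lab y \<or> fst (lab x) \<noteq> fst (lab y)"
        using opp chanL[OF i L] by blast
    qed
    show "distinct (L i)"
      unfolding distinct_conv_nth
    proof (intro allI impI)
      fix j k assume "j < length (L i)" "k < length (L i)" "j \<noteq> k"
      then show "L i ! j \<noteq> L i ! k"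
        using sL[OF i] unfolding sorted_wrt_iff_nth_less
        by (cases j k rule: linorder_cases) (metis less_irrefl)+
    qed
  next
    fix i assume "i < m"
    then have i: "i \<le> m" "Suc i \<le> m" by auto
    show "filter (\<lambda>x. x \<in> set (L (Suc i))) (L i) = filter (\<lambda>x. x \<in> set (L i)) (L (Suc i))"
    proof (rule sorted_wrt_key_unique[of ht])
      show "inj_on ht (set (filter (\<lambda>x. x \<in> set (L (Suc i))) (L i)))"
        using inj[OF i(1)] setL[OF i(1)] by (auto intro: inj_on_subset)
    qed (use sL i in \<open>auto intro: sorted_wrt_filter\<close>)
  next
    fix i j k x assume *: "i \<le> j" "j \<le> k" "k \<le> m" "x \<in> set (L i)" "x \<in> set (L k)"
    then have "x \<in> Col i" "x \<in> Col k" using setL by auto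
    then have "x \<in> Col j"
      using mono'[of i j] mono'[of "Suc j" "Suc k"] * m[of k] by (auto simp: Col_def)
    then show "x \<in> set (L j)" using setL * by auto
  next
    have "es ! 0 \<in> P" using setes len by (metis nth_mem order_less_le_trans zero_less_numeral)
    then obtain k where k: "k \<in> T" "es ! 0 = lf k \<or> es ! 0 = rt k" by (auto simp: P_def)
    obtain j where j: "j < length es" "lf k = es ! j" using setes ends(1)[OF k(1)] by (metis in_set_conv_nth)
    have lk: "lf k \<le> es ! 0" "es ! 0 < rt k" using k mono'[of 0 j] j pos[OF k(1)] by auto
    then have "k \<in> Col 0" using gap[OF ends(2)[OF k(1)], of 0] k by (auto simp: Col_def)
    then show "L 0 \<noteq> []" using setL[of 0] by auto
  qed
  moreover have "card (\<Union>i\<le>m. set (L i)) \<le> card T"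
    using fin setL by (intro card_mono) (auto simp: Col_def)
  moreover have "card E \<le> card (\<Union>i\<le>m. pairs lab (L i))"
  proof (intro card_mono subsetI)
    fix e assume "e \<in> E"
    from E[OF this] obtain p q where pq: "p \<in> T" "q \<in> T" "e = {lab p, lab q}" "fst (lab p) \<noteq> fst (lab q)" "chan T p q"
      by blast
    from pq(5) obtain a b where ab: "a < b" "lf p \<le> a" "b \<le> rt p" "lf q \<le> a" "b \<le> rt q" "ht p < ht q"
      "\<forall>k \<in> T - {p, q}. ht p < ht k \<and> ht k < ht q \<longrightarrow> rt k \<le> a \<or> b \<le> lf k"
      unfolding chan_def by (elim exE conjE) (rule that)
    \<comment> \<open>The last endpoint not to the right of \<open>a\<close> starts an elementary
      interval that overlaps the channel in positive width. So \<open>p\<close> and \<open>q\<close>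
      are in its column, and any bar between them there would block the channel.\<close>
    define I where "I = {i. i < length es \<and> es ! i \<le> a}"
    have finI: "finite I" by (simp add: I_def)
    obtain j where j: "j < length es" "lf p = es ! j" using setes ends(1)[OF pq(1)] by (metis in_set_conv_nth)
    obtain j' where j': "j' < length es" "rt p = es ! j'" using setes ends(2)[OF pq(1)] by (metis in_set_conv_nth)
    have neI: "I \<noteq> {}" using j ab by (auto simp: I_def)
    define i where "i = Max I"
    have "i \<in> I" unfolding i_def using finI neI by (rule Max_in)
    then have i: "i < length es" "es ! i \<le> a" by (auto simp: I_def)
    have "i < j'" using mono'[of j' i] i j' ab by (cases "i < j'") auto
    then have im: "i \<le> m" using j' by (simp add: m_def)
    have "Suc i \<notin> I" using Max_ge[OF finI, of "Suc i"] by (auto simp: i_def)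
    then have ia: "a < es ! Suc i" using m[OF im] by (auto simp: I_def)
    have inC: "k \<in> Col i" if "k \<in> T" "lf k \<le> a" "b \<le> rt k" for k
      using gap[OF ends(1) im, of k] gap[OF ends(2) im, of k] that i ia ab(1) by (auto simp: Col_def)
    have "\<exists>as bs. L i = as @ p # q # bs"
    proof (rule sorted_wrt_key_consecutive[OF sL[OF im]])
      show "p \<in> set (L i)" "q \<in> set (L i)" using inC pq ab setL[OF im] by auto
      show "\<not> (ht p < ht k \<and> ht k < ht q)" if "k \<in> set (L i)" for k
        using ab(7) that ia i ab(1) setL[OF im] by (force simp: Col_def)
    qed (use ab in auto)
    then obtain as bs where "L i = as @ p # q # bs" by blast
    then have "e \<in> pairs lab (L i)" using in_pairsI[of lab p q as bs] pq by simp
    then show "e \<in> (\<Union>i\<le>m. pairs lab (L i))" using im by blast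
  qed auto
  ultimately show ?thesis by linarith
qed

section \<open>The graph \<open>K\<^bsub>3,3\<^esub>\<close>\<close>

text \<open>Symmetric in \<open>a\<close> and \<open>b\<close>, as it is unknown which of them is
  lower. The interval is kept because the argument asks past which end of a third bar it
  runs.\<close>

definition vis :: "('i \<Rightarrow> real) \<Rightarrow> ('i \<Rightarrow> real) \<Rightarrow> ('i \<Rightarrow> real) \<Rightarrow> 'i set \<Rightarrow> 'i \<Rightarrow> 'i \<Rightarrow> real \<Rightarrow> real \<Rightarrow> bool" where
  "vis l r y S a b p q \<longleftrightarrow> p < q \<and> l a \<le> p \<and> q \<le> r a \<and> l b \<le> p \<and> q \<le> r b \<and>
     (\<forall>k\<in>S. y a < y k \<and> y k < y b \<or> y b < y k \<and> y k < y a \<longrightarrow> r k \<le> p \<or> q \<le> l k)"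

text \<open>\<open>sepA\<close> and \<open>sepB\<close> sharpen nonadjacency: the blocking bar can
  be taken from the opposite side. Coordinates are separate functions so that both reflections are
  mere negations.\<close>

locale k33_config =
  fixes l r y :: "'i \<Rightarrow> real" and A B :: "'i set"
  assumes fin: "finite A" "finite B" and card: "card A = 3" "card B = 3"
    and neq: "i \<in> A \<union> B \<Longrightarrow> j \<in> A \<union> B \<Longrightarrow> i \<noteq> j \<Longrightarrow> l i < r j \<Longrightarrow> l j < r i \<Longrightarrow> y i \<noteq> y j"
    and sees: "a \<in> A \<Longrightarrow> b \<in> B \<Longrightarrow> \<exists>p q. vis l r y (A \<union> B) a b p q"
    and sepA: "a \<in> A \<Longrightarrow> a' \<in> A \<Longrightarrow> p < q \<Longrightarrow> l a \<le> p \<Longrightarrow> q \<le> r a \<Longrightarrow> l a' \<le> p \<Longrightarrow> q \<le> r a' \<Longrightarrow>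
       y a < y a' \<Longrightarrow> \<exists>k\<in>B. y a < y k \<and> y k < y a' \<and> p < r k \<and> l k < q"
    and sepB: "b \<in> B \<Longrightarrow> b' \<in> B \<Longrightarrow> p < q \<Longrightarrow> l b \<le> p \<Longrightarrow> q \<le> r b \<Longrightarrow> l b' \<le> p \<Longrightarrow> q \<le> r b' \<Longrightarrow>
       y b < y b' \<Longrightarrow> \<exists>k\<in>A. y b < y k \<and> y k < y b' \<and> p < r k \<and> l k < q"
    and disj: "A \<inter> B = {}"
begin

section \<open>Symmetries of the configuration\<close>

lemma swap: "k33_config l r y B A"
proof
  show "\<exists>p q. vis l r y (B \<union> A) a b p q" if "a \<in> B" "b \<in> A" for a b
    using sees[OF that(2,1)] unfolding vis_def by (auto simp: Un_commute)
qed (use fin card disj neq sepA sepB in \<open>auto simp: Un_commute\<close>)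

lemma mirror: "k33_config (\<lambda>i. - r i) (\<lambda>i. - l i) y A B"
proof
  show "\<exists>p q. vis (\<lambda>i. - r i) (\<lambda>i. - l i) y (A \<union> B) a b p q" if ab: "a \<in> A" "b \<in> B" for a b
  proof -
    obtain p q where "vis l r y (A \<union> B) a b p q" using sees[OF ab] by blast
    then have "vis (\<lambda>i. - r i) (\<lambda>i. - l i) y (A \<union> B) a b (- q) (- p)" unfolding vis_def by auto
    then show ?thesis by blast
  qed
  show "\<exists>k\<in>B. y a < y k \<and> y k < y a' \<and> p < - l k \<and> - r k < q"
    if "a \<in> A" "a' \<in> A" "p < q" "- r a \<le> p" "q \<le> - l a" "- r a' \<le> p" "q \<le> - l a'" "y a < y a'" for a a' p q
  proof -
    have "\<exists>k\<in>B. y a < y k \<and> y k < y a' \<and> - q < r k \<and> l k < - p"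
      by (rule sepA) (use that in auto)
    then show ?thesis by force
  qed
  show "\<exists>k\<in>A. y b < y k \<and> y k < y b' \<and> p < - l k \<and> - r k < q"
    if "b \<in> B" "b' \<in> B" "p < q" "- r b \<le> p" "q \<le> - l b" "- r b' \<le> p" "q \<le> - l b'" "y b < y b'" for b b' p q
  proof -
    have "\<exists>k\<in>A. y b < y k \<and> y k < y b' \<and> - q < r k \<and> l k < - p"
      by (rule sepB) (use that in auto)
    then show ?thesis by force
  qed
qed (use fin card disj neq in auto)

lemma flip: "k33_config l r (\<lambda>i. - y i) A B"
proof
  show "\<exists>p q. vis l r (\<lambda>i. - y i) (A \<union> B) a b p q" if ab: "a \<in> A" "b \<in> B" for a b
    using sees[OF ab] unfolding vis_def by auto
  show "\<exists>k\<in>B. - y a < - y k \<and> - y k < - y a' \<and> p < r k \<and> l k < q"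
    if "a \<in> A" "a' \<in> A" "p < q" "l a \<le> p" "q \<le> r a" "l a' \<le> p" "q \<le> r a'" "- y a < - y a'" for a a' p q
    using sepA[of a' a p q] that by auto
  show "\<exists>k\<in>A. - y b < - y k \<and> - y k < - y b' \<and> p < r k \<and> l k < q"
    if "b \<in> B" "b' \<in> B" "p < q" "l b \<le> p" "q \<le> r b" "l b' \<le> p" "q \<le> r b'" "- y b < - y b'" for b b' p q
    using sepB[of b' b p q] that by auto
qed (use fin card disj neq in auto)

lemma overlap: "a \<in> A \<Longrightarrow> b \<in> B \<Longrightarrow> l a < r b \<and> l b < r a"
  using sees[of a b] unfolding vis_def by force

text \<open>Such a \<open>u\<close> extends beyond both ends of \<open>v1\<close>: on the right to
  see \<open>v3\<close>, on the left to see \<open>v2\<close>. It thereby closes the left side to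
  the bars of \<open>A\<close> that separate \<open>v1\<close> from \<open>v2\<close> and
  \<open>v2\<close> from \<open>v3\<close>; both have to pass \<open>v2\<close> on the right, where
  nothing in \<open>B\<close> keeps them apart.\<close>

lemma no_outer_bar:
  assumes B: "B = {v1, v2, v3}" "y v1 < y v2" "y v2 < y v3"
    and I: "p0 < q0" "\<And>v. v \<in> B \<Longrightarrow> l v \<le> p0 \<and> q0 \<le> r v"
    and u: "u \<in> A" "y u < y v1" "vis l r y (A \<union> B) u v3 p1 q1" "r v2 \<le> p1" "r v2 < r v1"
  shows False
proof -
  have v: "l v1 \<le> p0" "q0 \<le> r v1" "l v2 \<le> p0" "q0 \<le> r v2" "l v3 \<le> p0" "q0 \<le> r v3"
    using I(2)[of v1] I(2)[of v2] I(2)[of v3] B(1) by simp_all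
  have u1: "p1 < q1" "l u \<le> p1" "q1 \<le> r u" using u(3) by (auto simp: vis_def)
  have "r v1 \<le> p1 \<or> q1 \<le> l v1" using u(2,3) B by (auto simp: vis_def)
  then have rv1: "r v1 \<le> p1" using v I(1) u1 u(4) B by auto
  obtain p2 q2 where u2: "vis l r y (A \<union> B) u v2 p2 q2" using sees[OF u(1), of v2] B by blast
  then have "r v1 \<le> p2 \<or> q2 \<le> l v1" using u(2) B by (auto simp: vis_def)
  then have lv1: "q2 \<le> l v1" using u2 u(5) by (auto simp: vis_def)
  have p2: "p2 < q2" "l u \<le> p2" "l v2 \<le> p2" using u2 by (auto simp: vis_def)
  obtain k where k: "k \<in> A" "y v1 < y k" "y k < y v2" "p0 < r k" "l k < q0"
    using sepB[of v1 v2 p0 q0] B I v by auto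
  obtain k' where k': "k' \<in> A" "y v2 < y k'" "y k' < y v3" "p0 < r k'" "l k' < q0"
    using sepB[of v2 v3 p0 q0] B I v by auto
  have right: "r v2 \<le> pz"
    if z: "z \<in> A" "p0 < r z" "y v1 < y z" "vis l r y (A \<union> B) z b pz qz"
      and zb: "b = v3 \<and> y z < y v2 \<or> b = v1 \<and> y v2 < y z" for z b pz qz
  proof (rule ccontr)
    assume "\<not> r v2 \<le> pz"
    moreover have "r v2 \<le> pz \<or> qz \<le> l v2" using z(4) zb B by (auto simp: vis_def)
    ultimately have left: "qz \<le> l v2" by simp
    have pz: "pz < qz" "l z \<le> pz" "l b \<le> pz" using z(4) by (auto simp: vis_def)
    \<comment> \<open>Left of \<open>v1\<close> the bars \<open>u\<close> and \<open>z\<close> would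
      overlap; the bar of \<open>B\<close> between them starts left of \<open>v1\<close> and so is a
      different one.\<close>
    have "\<exists>k2\<in>B. y u < y k2 \<and> y k2 < y z \<and> max p2 pz < r k2 \<and> l k2 < l v1"
      by (rule sepA) (use u(1,2,5) z(1,2,3) v I(1) u1 rv1 p2 pz left lv1 in linarith)+
    then obtain k2 where k2: "k2 \<in> B" "y k2 < y z" "l k2 < l v1" by blast
    then have "k2 = v2 \<or> k2 = v3" using B(1) by auto
    then have "y v2 < y z" using k2 B by auto
    then have "b = v1" using zb by auto
    then show False using pz left p2 lv1 by auto
  qed
  obtain pk qk where vk: "vis l r y (A \<union> B) k v3 pk qk" using sees[OF k(1), of v3] B by blast
  obtain pk' qk' where vk': "vis l r y (A \<union> B) k' v1 pk' qk'" using sees[OF k'(1), of v1] B by blast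
  have "r v2 \<le> pk" by (rule right[of k v3]) (use k vk in auto)
  moreover have "r v2 \<le> pk'" by (rule right[of k' v1]) (use k' vk' B in auto)
  \<comment> \<open>Of the bars in \<open>B\<close> only \<open>v2\<close> lies between
    \<open>k\<close> and \<open>k'\<close> in height, and it ends where this overlap begins.\<close>
  ultimately have "\<exists>k3\<in>B. y k < y k3 \<and> y k3 < y k' \<and> r v2 < r k3 \<and> l k3 < min qk qk'"
    by (intro sepA) (use k k' vk vk' v B in \<open>auto simp: vis_def\<close>)
  then obtain k3 where "k3 \<in> B" "y k < y k3" "y k3 < y k'" "r v2 < r k3" by blast
  then show False using k k' B by auto
qed

text \<open>Two bars of \<open>A\<close> that pass \<open>v2\<close> on the right overlap there, so
  \<open>v1\<close> or \<open>v3\<close> lies between them in height and is longer than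
  \<open>v2\<close> on the right. Then one of the two is below \<open>v1\<close> or above
  \<open>v3\<close>, which \<open>no_outer_bar\<close> and its vertical reflection exclude.\<close>

lemma not_two_right:
  assumes B: "B = {v1, v2, v3}" "y v1 < y v2" "y v2 < y v3"
    and I: "p0 < q0" "\<And>v. v \<in> B \<Longrightarrow> l v \<le> p0 \<and> q0 \<le> r v"
    and u: "u \<in> A" "u' \<in> A" "u \<noteq> u'"
    and ux: "vis l r y (A \<union> B) u b p q" "r v2 \<le> p" "b = v3 \<and> y u < y v2 \<or> b = v1 \<and> y v2 < y u"
    and ux': "vis l r y (A \<union> B) u' b' p' q'" "r v2 \<le> p'" "b' = v3 \<and> y u' < y v2 \<or> b' = v1 \<and> y v2 < y u'"
  shows False
proof -
  have *: False if uu: "u \<in> A" "u' \<in> A" "y u < y u'"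
    and ux: "vis l r y (A \<union> B) u b p q" "r v2 \<le> p" "b = v3 \<and> y u < y v2 \<or> b = v1 \<and> y v2 < y u"
    and ux': "vis l r y (A \<union> B) u' b' p' q'" "r v2 \<le> p'" "b' = v3 \<and> y u' < y v2 \<or> b' = v1 \<and> y v2 < y u'"
    for u u' b b' p p' q q'
  proof -
    have v2: "l u < r v2" "l u' < r v2" using overlap[of _ v2] uu B by auto
    have "\<exists>k\<in>B. y u < y k \<and> y k < y u' \<and> r v2 < r k \<and> l k < min q q'"
      by (rule sepA) (use uu ux ux' v2 in \<open>auto simp: vis_def\<close>)
    then obtain k where k: "k \<in> B" "y u < y k" "y k < y u'" "r v2 < r k" by blast
    then consider "k = v1" | "k = v3" using B(1) by auto
    then show False
    proof cases
      case 1
      then show False using no_outer_bar[OF B I uu(1), of p q] ux k B by auto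
    next
      case 2
      interpret f: k33_config l r "\<lambda>i. - y i" A B by (rule flip)
      have "vis l r (\<lambda>i. - y i) (A \<union> B) u' v1 p' q'"
        using ux' k 2 B unfolding vis_def by auto
      moreover have "B = {v3, v2, v1}" using B(1) by blast
      ultimately show False
        using f.no_outer_bar[of v3 v2 v1 p0 q0 u' p' q'] B(2,3) I uu(2) ux'(2) k(3,4) 2 by simp
    qed
  qed
  have "l u < r v2" "l u' < r v2" using overlap[of _ v2] u B by auto
  then have "y u \<noteq> y u'" using ux ux' u by (intro neq) (auto simp: vis_def)
  then consider "y u < y u'" | "y u' < y u" by linarith
  then show False
    using *[OF u(1,2) _ ux ux'] *[OF u(2,1) _ ux' ux] by cases
qed

lemma no_common:
  assumes "p0 < q0" "\<And>v. v \<in> B \<Longrightarrow> l v \<le> p0 \<and> q0 \<le> r v"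
  shows False
proof -
  have "\<exists>xs. set xs = B \<and> sorted_wrt (\<lambda>a b. y a < y b) xs"
  proof (rule ex_sorted_wrt_key)
    show "inj_on y B"
    proof (rule inj_onI, rule ccontr)
      fix a b assume "a \<in> B" "b \<in> B" "y a = y b" "a \<noteq> b"
      then show False using neq[of a b] assms(2)[of a] assms(2)[of b] assms(1) by auto
    qed
  qed (rule fin)
  then obtain xs where xs: "set xs = B" "sorted_wrt (\<lambda>a b. y a < y b) xs" by blast
  have "length xs \<noteq> 0" "length xs \<noteq> 1" "length xs \<noteq> 2"
    using card(2) card_length[of xs] xs(1) by auto
  then obtain v1 v2 v3 zs where zs: "xs = v1 # v2 # v3 # zs"
    by (cases xs; cases "tl xs"; cases "tl (tl xs)") auto
  have "distinct xs" unfolding distinct_conv_nth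
  proof (intro allI impI)
    fix j k assume "j < length xs" "k < length xs" "j \<noteq> k"
    then show "xs ! j \<noteq> xs ! k"
      using xs(2) unfolding sorted_wrt_iff_nth_less by (cases j k rule: linorder_cases) (metis less_irrefl)+
  qed
  then have "length xs = 3" using card(2) xs(1) distinct_card by metis
  then have B: "B = {v1, v2, v3}" "y v1 < y v2" "y v2 < y v3" using xs zs by auto
  \<comment> \<open>\<open>u\<close> sees the bar of \<open>B\<close> on the far side of
    \<open>v2\<close>, so its channel crosses the height of \<open>v2\<close> past one end of
    \<open>v2\<close>.\<close>
  let ?c = "\<lambda>u b p q. vis l r y (A \<union> B) u b p q \<and> (b = v3 \<and> y u < y v2 \<or> b = v1 \<and> y v2 < y u)"
  have "\<exists>b p q. ?c u b p q \<and> (r v2 \<le> p \<or> q \<le> l v2)" if u: "u \<in> A" for u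
  proof -
    have "y u \<noteq> y v2" using overlap[OF u, of v2] u B disj by (intro neq) auto
    then consider "y u < y v2" | "y v2 < y u" by linarith
    then show ?thesis
    proof cases
      case 1
      obtain p q where "vis l r y (A \<union> B) u v3 p q" using sees[OF u, of v3] B by blast
      moreover have "r v2 \<le> p \<or> q \<le> l v2" using calculation 1 B by (auto simp: vis_def)
      ultimately show ?thesis using 1 by blast
    next
      case 2
      obtain p q where "vis l r y (A \<union> B) u v1 p q" using sees[OF u, of v1] B by blast
      moreover have "r v2 \<le> p \<or> q \<le> l v2" using calculation 2 B by (auto simp: vis_def)
      ultimately show ?thesis using 2 by blast
    qed
  qed
  then have side: "(\<exists>b p q. ?c u b p q \<and> r v2 \<le> p) \<or> (\<exists>b p q. ?c u b p q \<and> q \<le> l v2)" if "u \<in> A" for u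
    using that by blast
  have R: "\<not> (\<exists>b p q. ?c u b p q \<and> r v2 \<le> p) \<or> \<not> (\<exists>b p q. ?c u' b p q \<and> r v2 \<le> p)"
    if "u \<in> A" "u' \<in> A" "u \<noteq> u'" for u u'
    using not_two_right[OF B assms(1,2) that] by blast
  interpret m: k33_config "\<lambda>i. - r i" "\<lambda>i. - l i" y A B by (rule mirror)
  have mv: "vis (\<lambda>i. - r i) (\<lambda>i. - l i) y (A \<union> B) u b (- q) (- p)" if "vis l r y (A \<union> B) u b p q" for u b p q
    using that unfolding vis_def by auto
  have L: "\<not> (\<exists>b p q. ?c u b p q \<and> q \<le> l v2) \<or> \<not> (\<exists>b p q. ?c u' b p q \<and> q \<le> l v2)"
    if "u \<in> A" "u' \<in> A" "u \<noteq> u'" for u u'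
  proof (rule ccontr)
    assume "\<not> ?thesis"
    then obtain b p q b' p' q' where "?c u b p q" "q \<le> l v2" "?c u' b' p' q'" "q' \<le> l v2" by blast
    then show False
      using m.not_two_right[OF B, of "- q0" "- p0" u u' b "- q" "- p" b' "- q'" "- p'"] assms that mv by auto
  qed
  obtain a1 a2 a3 where "A = {a1, a2, a3}" "a1 \<noteq> a2" "a1 \<noteq> a3" "a2 \<noteq> a3"
    using card(1) by (auto simp: card_3_iff)
  then have "a1 \<in> A" "a2 \<in> A" "a3 \<in> A" and ne: "a1 \<noteq> a2" "a1 \<noteq> a3" "a2 \<noteq> a3" by auto
  then show False
    using side[of a1] side[of a2] side[of a3] R[OF _ _ ne(1)] R[OF _ _ ne(2)] R[OF _ _ ne(3)]
      L[OF _ _ ne(1)] L[OF _ _ ne(2)] L[OF _ _ ne(3)]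
    by argo
qed

text \<open>If \<open>v\<close> ends before \<open>v'\<close> starts, every bar of \<open>A\<close>
  overlaps both and so reaches across; this gives \<open>A\<close> a common interval. Otherwise the
  intervals of \<open>B\<close> overlap pairwise, and Helly's theorem on the line gives one for
  \<open>B\<close>.\<close>

lemma contradiction: False
proof (cases "\<exists>v\<in>B. \<exists>v'\<in>B. r v \<le> l v'")
  case True
  then obtain v v' where v: "v \<in> B" "v' \<in> B" "r v \<le> l v'" by blast
  interpret s: k33_config l r y B A by (rule swap)
  have A: "A \<noteq> {}" using card by auto
  have "Max (l ` A) \<in> l ` A" "Min (r ` A) \<in> r ` A" using A fin by auto
  then obtain a a' where a: "a \<in> A" "a' \<in> A" "Max (l ` A) = l a" "Min (r ` A) = r a'" by blast
  then have "Max (l ` A) < Min (r ` A)" using overlap[of a v] overlap[of a' v'] v by simp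
  then show False by (rule s.no_common) (use fin in auto)
next
  case False
  have B: "B \<noteq> {}" using card by auto
  have "Max (l ` B) \<in> l ` B" "Min (r ` B) \<in> r ` B" using B fin by auto
  then obtain b b' where b: "b \<in> B" "b' \<in> B" "Max (l ` B) = l b" "Min (r ` B) = r b'" by blast
  then have "Max (l ` B) < Min (r ` B)" using False by force
  then show False by (rule no_common) (use fin in auto)
qed

end

section \<open>Lower bounds for representations\<close>

text \<open>The bars of all vertices are pooled; \<open>own\<close> can be a function because no bar
  serves two vertices.\<close>

locale segment_rep =
  fixes t :: nat and G :: "('a, 'b) pre_digraph" and T :: "(real \<times> real \<times> real) set"
    and own :: "real \<times> real \<times> real \<Rightarrow> 'a"
  assumes finT: "finite T" and pos: "k \<in> T \<Longrightarrow> lf k < rt k" and own: "k \<in> T \<Longrightarrow> own k \<in> verts G"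
    and disj: "i \<in> T \<Longrightarrow> j \<in> T \<Longrightarrow> i \<noteq> j \<Longrightarrow> ht i = ht j \<Longrightarrow> rt i < lf j \<or> rt j < lf i"
    and num: "w \<in> verts G \<Longrightarrow> card {p \<in> T. own p = w} \<le> t"
    and adj: "u \<in> verts G \<Longrightarrow> v \<in> verts G \<Longrightarrow> u \<noteq> v \<Longrightarrow>
       u \<rightarrow>\<^bsub>G\<^esub> v \<longleftrightarrow> (\<exists>p\<in>T. \<exists>q\<in>T. own p = u \<and> own q = v \<and> (chan T p q \<or> chan T q p))"

lemma rep_segments:
  assumes rep: "bar_visibility_rep t G \<beta>" and fin: "finite (verts G)"
  shows "\<exists>T own. segment_rep t G T own"
proof -
  have R1: "finite (\<beta> w) \<and> card (\<beta> w) \<le> t \<and> (\<forall>B\<in>\<beta> w. is_bar B) \<and> pairwise disjnt (\<beta> w)" if "w \<in> verts G" for w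
    using rep that unfolding bar_visibility_rep_def by (elim conjE) (erule (1) bspec)
  have R2: "disjnt B C" if "u \<in> verts G" "v \<in> verts G" "u \<noteq> v" "B \<in> \<beta> u" "C \<in> \<beta> v" for u v B C
    using rep that unfolding bar_visibility_rep_def by (elim conjE) metis
  have R3: "u \<rightarrow>\<^bsub>G\<^esub> v \<longleftrightarrow> (\<exists>B\<in>\<beta> u. \<exists>C\<in>\<beta> v. sees (\<Union>w\<in>verts G. \<beta> w) B C)"
    if "u \<in> verts G" "v \<in> verts G" "u \<noteq> v" for u v
    using rep that unfolding bar_visibility_rep_def by (elim conjE) metis
  define T where "T = {p. lf p < rt p \<and> hbar p \<in> (\<Union>w\<in>verts G. \<beta> w)}"
  have pos: "lf k < rt k" if "k \<in> T" for k using that by (simp add: T_def)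
  have bars: "\<exists>p\<in>T. B = hbar p" if "w \<in> verts G" "B \<in> \<beta> w" for w B
  proof -
    have "is_bar B" using R1 that by blast
    then obtain p where "lf p < rt p" "B = hbar p" by (auto simp: is_bar_hbar)
    moreover from this that have "p \<in> T" by (auto simp: T_def simp del: split_paired_Ex)
    ultimately show ?thesis by blast
  qed
  have img: "hbar ` T = (\<Union>w\<in>verts G. \<beta> w)"
  proof
    show "hbar ` T \<subseteq> (\<Union>w\<in>verts G. \<beta> w)" by (auto simp: T_def)
    show "(\<Union>w\<in>verts G. \<beta> w) \<subseteq> hbar ` T" using bars by fast
  qed
  have inj: "inj_on hbar T"
    by (rule inj_onI) (use hbar_eq_iff pos in blast)
  have "finite (hbar ` T)" unfolding img using R1 fin by blast
  then have finT: "finite T" using inj finite_imageD by blast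
  define own where "own p = (SOME w. w \<in> verts G \<and> hbar p \<in> \<beta> w)" for p
  have own: "own p \<in> verts G \<and> hbar p \<in> \<beta> (own p)" if "p \<in> T" for p
    unfolding own_def by (rule someI_ex) (use that in \<open>auto simp: T_def\<close>)
  have uniq: "own p = w" if "p \<in> T" "w \<in> verts G" "hbar p \<in> \<beta> w" for p w
  proof (rule ccontr)
    assume "own p \<noteq> w"
    then have "disjnt (hbar p) (hbar p)" using R2 own[OF that(1)] that by blast
    then show False using pos[OF that(1)] by (auto simp: hbar_def)
  qed
  have disj: "rt i < lf j \<or> rt j < lf i" if ij: "i \<in> T" "j \<in> T" "i \<noteq> j" "ht i = ht j" for i j
  proof -
    have ne: "hbar i \<noteq> hbar j" using inj ij by (auto dest: inj_onD)
    have "disjnt (hbar i) (hbar j)"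
    proof (cases "own i = own j")
      case True
      then have "hbar i \<in> \<beta> (own i)" "hbar j \<in> \<beta> (own i)" "pairwise disjnt (\<beta> (own i))"
        using own[OF ij(1)] own[OF ij(2)] R1 by auto
      then show ?thesis using ne by (auto simp: pairwise_def)
    next
      case False
      then show ?thesis using own[OF ij(1)] own[OF ij(2)] R2 by blast
    qed
    then show ?thesis using disjnt_hbar pos ij by blast
  qed
  have num: "card {p \<in> T. own p = w} \<le> t" if w: "w \<in> verts G" for w
  proof -
    have "hbar ` {p \<in> T. own p = w} \<subseteq> \<beta> w" using own by auto
    then have "card (hbar ` {p \<in> T. own p = w}) \<le> card (\<beta> w)" using R1[OF w] by (intro card_mono) auto
    moreover have "card (hbar ` {p \<in> T. own p = w}) = card {p \<in> T. own p = w}"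
      by (rule card_image) (use inj in \<open>auto intro: inj_on_subset\<close>)
    moreover have "card (\<beta> w) \<le> t" using R1[OF w] by blast
    ultimately show ?thesis by linarith
  qed
  have adj: "u \<rightarrow>\<^bsub>G\<^esub> v \<longleftrightarrow> (\<exists>p\<in>T. \<exists>q\<in>T. own p = u \<and> own q = v \<and> (chan T p q \<or> chan T q p))"
    if uv: "u \<in> verts G" "v \<in> verts G" "u \<noteq> v" for u v
  proof -
    have "u \<rightarrow>\<^bsub>G\<^esub> v \<longleftrightarrow> (\<exists>B\<in>\<beta> u. \<exists>C\<in>\<beta> v. sees (hbar ` T) B C)"
      unfolding img by (rule R3[OF uv])
    also have "\<dots> \<longleftrightarrow> (\<exists>p\<in>T. \<exists>q\<in>T. own p = u \<and> own q = v \<and> sees (hbar ` T) (hbar p) (hbar q))"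
      (is "?L \<longleftrightarrow> ?R")
    proof
      assume ?L
      then obtain B C where BC: "B \<in> \<beta> u" "C \<in> \<beta> v" "sees (hbar ` T) B C" by blast
      obtain p where p: "p \<in> T" "B = hbar p" using bars uv(1) BC(1) by blast
      obtain q where q: "q \<in> T" "C = hbar q" using bars uv(2) BC(2) by blast
      show ?R using BC p q uniq uv by blast
    next
      assume ?R
      then show ?L using own by blast
    qed
    also have "\<dots> \<longleftrightarrow> (\<exists>p\<in>T. \<exists>q\<in>T. own p = u \<and> own q = v \<and> (chan T p q \<or> chan T q p))"
      by (intro bex_cong refl) (simp add: sees_hbar[OF pos])
    finally show ?thesis .
  qed
  have "segment_rep t G T own"
    by unfold_locales (use finT pos own disj num adj in simp_all)
  then show ?thesis by blast
qed

context segment_rep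
begin

lemma lower_bound:
  assumes K: "K\<^bsub>n,n\<^esub> G" and n: "0 < n"
  shows "n < 4 * t"
proof -
  obtain U V where UV: "verts G = U \<union> V" "U \<inter> V = {}" "card U = n" "card V = n" "arcs_ends G = U \<times> V \<union> V \<times> U"
    using K unfolding complete_bipartite_digraph_def by blast
  have fin: "finite U" "finite V" using UV n card.infinite by fastforce+
  then have finV: "finite (verts G)" using UV by simp
  define lab where "lab p = (own p \<in> U, own p)" for p
  define E where "E = (\<lambda>(u, v). {(True, u), (False, v)}) ` (U \<times> V)"
  have E: "\<exists>p\<in>T. \<exists>q\<in>T. e = {lab p, lab q} \<and> fst (lab p) \<noteq> fst (lab q) \<and> chan T p q" if e: "e \<in> E" for e
  proof -
    from e obtain u v where uv: "u \<in> U" "v \<in> V" "e = {(True, u), (False, v)}" by (auto simp: E_def)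
    then have "u \<rightarrow>\<^bsub>G\<^esub> v" "u \<noteq> v" "v \<notin> U" using UV by auto
    then obtain p q where pq: "p \<in> T" "q \<in> T" "own p = u" "own q = v" "chan T p q \<or> chan T q p"
      using adj[of u v] uv UV by auto
    then have "lab p = (True, u)" "lab q = (False, v)" using uv \<open>v \<notin> U\<close> by (auto simp: lab_def)
    then show ?thesis
      using pq uv by (metis fst_conv insert_commute)
  qed
  have "inj_on (\<lambda>(u, v). {(True, u), (False, v)}) (U \<times> V)"
    by (auto simp: inj_on_def doubleton_eq_iff)
  then have cE: "card E = n * n" unfolding E_def using UV by (simp add: card_image card_cartesian_product)
  have opp: "lab p = lab q \<or> fst (lab p) \<noteq> fst (lab q)" if pq: "p \<in> T" "q \<in> T" "chan T p q" for p q
  proof (cases "own p = own q")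
    case True
    then show ?thesis by (simp add: lab_def)
  next
    case False
    then have "own p \<rightarrow>\<^bsub>G\<^esub> own q" using adj[of "own p" "own q"] own pq by auto
    then have "own p \<in> U \<and> own q \<in> V \<or> own p \<in> V \<and> own q \<in> U" using UV by auto
    then show ?thesis using UV(2) by (auto simp: lab_def)
  qed
  have "E \<noteq> {}" using cE n by auto
  then have "T \<noteq> {}" using E by fastforce
  then have "card E + 2 \<le> 2 * card T"
    using bar_config_bound[of T lab E] finT pos disj opp E by blast
  moreover have "card T \<le> 2 * n * t"
  proof -
    have "T = (\<Union>w\<in>verts G. {p \<in> T. own p = w})" using own by auto
    then have "card T \<le> (\<Sum>w\<in>verts G. card {p \<in> T. own p = w})"
      using card_UN_le[OF finV, of "\<lambda>w. {p \<in> T. own p = w}"] by simp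
    also have "\<dots> \<le> (\<Sum>w\<in>verts G. t)" by (rule sum_mono) (rule num)
    also have "\<dots> = 2 * n * t" using UV fin by (simp add: card_Un_disjoint)
    finally show ?thesis .
  qed
  ultimately have "n * n + 2 \<le> n * (4 * t)" using cE by simp
  then have "n * n < n * (4 * t)" by linarith
  then show ?thesis by simp
qed

lemma K33_lower_bound:
  assumes K: "K\<^bsub>3,3\<^esub> G"
  shows "2 \<le> t"
proof (rule ccontr)
  assume "\<not> 2 \<le> t"
  then have t: "t \<le> 1" by simp
  obtain U V where UV: "verts G = U \<union> V" "U \<inter> V = {}" "card U = 3" "card V = 3" "arcs_ends G = U \<times> V \<union> V \<times> U"
    using K unfolding complete_bipartite_digraph_def by blast
  have fin: "finite U" "finite V" using UV card.infinite by fastforce+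
  then have finV: "finite (verts G)" using UV by simp
  have uniq: "p = q" if "p \<in> T" "q \<in> T" "own p = own q" for p q
  proof -
    have "card {k \<in> T. own k = own q} \<le> 1" using num[OF own[OF that(2)]] t by simp
    moreover have "finite {k \<in> T. own k = own q}" using finT by simp
    ultimately have "\<forall>x\<in>{k \<in> T. own k = own q}. \<forall>y\<in>{k \<in> T. own k = own q}. x = y"
      by (simp only: card_le_Suc0_iff_eq One_nat_def)
    then show ?thesis using that by blast
  qed
  have "\<exists>p. p \<in> T \<and> own p = w" if "w \<in> verts G" for w
  proof -
    have "U \<noteq> {}" "V \<noteq> {}" using UV by auto
    then obtain u v where uv: "u \<in> U" "v \<in> V" by blast
    \<comment> \<open>Any vertex of the other side: being adjacent to it, \<open>w\<close> cannot be
      without a bar.\<close>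
    define w' where "w' = (if w \<in> U then v else u)"
    have "w' \<in> verts G" "w \<noteq> w'" "w \<rightarrow>\<^bsub>G\<^esub> w'" using uv that UV by (auto simp: w'_def)
    then show ?thesis using adj[OF that] by blast
  qed
  then have ex: "\<exists>p. p \<in> T \<and> own p = w" if "w \<in> verts G" for w using that .
  define bar where "bar w = (SOME p. p \<in> T \<and> own p = w)" for w
  have bar: "bar w \<in> T \<and> own (bar w) = w" if "w \<in> verts G" for w
    unfolding bar_def by (rule someI_ex) (rule ex[OF that])
  have T: "T = bar ` verts G"
  proof (intro equalityI subsetI)
    fix p assume "p \<in> T"
    then have "p = bar (own p)" using uniq[of p "bar (own p)"] bar[OF own] by auto
    then show "p \<in> bar ` verts G" using own \<open>p \<in> T\<close> by blast
  qed (use bar in auto)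
  let ?l = "\<lambda>w. lf (bar w)" and ?r = "\<lambda>w. rt (bar w)" and ?y = "\<lambda>w. ht (bar w)"
  have neq: "?y i \<noteq> ?y j" if "i \<in> verts G" "j \<in> verts G" "i \<noteq> j" "?l i < ?r j" "?l j < ?r i" for i j
  proof -
    have "bar i \<noteq> bar j" using bar that by metis
    then show ?thesis using disj[of "bar i" "bar j"] bar that by force
  qed
  have vis: "\<exists>p q. vis ?l ?r ?y (U \<union> V) a b p q" if ab: "a \<in> U" "b \<in> V" for a b
  proof -
    have ne: "a \<noteq> b" "a \<rightarrow>\<^bsub>G\<^esub> b" using ab UV by auto
    then have "chan T (bar a) (bar b) \<or> chan T (bar b) (bar a)"
    proof -
      have ab': "a \<in> verts G" "b \<in> verts G" using ab UV by auto
      then obtain p q where "p \<in> T" "q \<in> T" "own p = a" "own q = b" "chan T p q \<or> chan T q p"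
        using adj[of a b] ne by blast
      moreover from this have "p = bar a" "q = bar b" using uniq bar ab' by simp_all
      ultimately show ?thesis by simp
    qed
    then obtain p q where pq: "p < q" "?l a \<le> p" "q \<le> ?r a" "?l b \<le> p" "q \<le> ?r b"
      and blk: "\<forall>k\<in>T - {bar a, bar b}. ?y a < ht k \<and> ht k < ?y b \<or> ?y b < ht k \<and> ht k < ?y a \<longrightarrow> rt k \<le> p \<or> q \<le> lf k"
      unfolding chan_def by (elim disjE exE conjE) (rule that; auto)+
    have "?r k \<le> p \<or> q \<le> ?l k"
      if "k \<in> U \<union> V" "?y a < ?y k \<and> ?y k < ?y b \<or> ?y b < ?y k \<and> ?y k < ?y a" for k
    proof -
      have "bar k \<in> T - {bar a, bar b}" using that bar UV(1) by auto
      then show ?thesis using blk that(2) by blast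
    qed
    then show ?thesis using pq unfolding vis_def by blast
  qed
  have sep: "\<exists>k\<in>Y. ?y a < ?y k \<and> ?y k < ?y a' \<and> p < ?r k \<and> ?l k < q"
    if XY: "X \<union> Y = verts G" "card X = 3" "\<And>x x'. x \<in> X \<Longrightarrow> x' \<in> X \<Longrightarrow> \<not> x \<rightarrow>\<^bsub>G\<^esub> x'"
      and a: "a \<in> X" "a' \<in> X" "p < q" "?l a \<le> p" "q \<le> ?r a" "?l a' \<le> p" "q \<le> ?r a'" "?y a < ?y a'"
    for X Y a a' p q
  proof -
    have between: "\<exists>k\<in>verts G. ?y a < ?y k \<and> ?y k < ?y a' \<and> p < ?r k \<and> ?l k < q"
      if a: "a \<in> X" "a' \<in> X" "p < q" "?l a \<le> p" "q \<le> ?r a" "?l a' \<le> p" "q \<le> ?r a'" "?y a < ?y a'" for a a' p q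
    proof -
      have "a \<noteq> a'" using a by auto
      moreover have "a \<in> verts G" "a' \<in> verts G" "\<not> a \<rightarrow>\<^bsub>G\<^esub> a'" using a XY by auto
      ultimately have "\<not> chan T (bar a) (bar a')" using adj[of a a'] bar by blast
      then have "\<exists>k\<in>T - {bar a, bar a'}. ?y a < ht k \<and> ht k < ?y a' \<and> \<not> (rt k \<le> p \<or> q \<le> lf k)"
        unfolding chan_def using a by blast
      then obtain k where "k \<in> T" "?y a < ht k" "ht k < ?y a'" "\<not> (rt k \<le> p \<or> q \<le> lf k)" by blast
      moreover from this obtain w where "w \<in> verts G" "k = bar w" unfolding T by blast
      ultimately show ?thesis by (intro bexI[of _ w]) auto
    qed
    obtain k where k: "k \<in> verts G" "?y a < ?y k" "?y k < ?y a'" "p < ?r k" "?l k < q"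
      using between[OF a] by blast
    show ?thesis
    proof (cases "k \<in> Y")
      case False
      then have kX: "k \<in> X" using k XY by blast
      have lr: "?l k < ?r k" using pos bar k by blast
      \<comment> \<open>A blocker \<open>k\<close> in \<open>X\<close> itself is replaced by one
        between \<open>a\<close> and \<open>k\<close>; if that one were in \<open>X\<close> too,
        \<open>X\<close> would have four elements.\<close>
      have "\<exists>k'\<in>verts G. ?y a < ?y k' \<and> ?y k' < ?y k \<and> max p (?l k) < ?r k' \<and> ?l k' < min q (?r k)"
        by (rule between) (use a k kX lr in auto)
      then obtain k' where k': "k' \<in> verts G" "?y a < ?y k'" "?y k' < ?y k" "p < ?r k'" "?l k' < q" by auto
      have "k' \<notin> X"
      proof
        assume "k' \<in> X"
        then have "{a, a', k, k'} \<subseteq> X" using a kX by blast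
        then have "card {a, a', k, k'} \<le> card X" using XY(2) card.infinite by (intro card_mono) fastforce+
        moreover have "distinct [a, a', k, k']" using k k' by auto
        then have "card {a, a', k, k'} = 4" using distinct_card[of "[a, a', k, k']"] by simp
        ultimately show False using XY(2) by simp
      qed
      then show ?thesis using k' k XY(1) by (intro bexI[of _ k']) auto
    qed (use k in blast)
  qed
  interpret k33_config ?l ?r ?y U V
  proof
    show "\<exists>k\<in>V. ?y a < ?y k \<and> ?y k < ?y a' \<and> p < ?r k \<and> ?l k < q"
      if "a \<in> U" "a' \<in> U" "p < q" "?l a \<le> p" "q \<le> ?r a" "?l a' \<le> p" "q \<le> ?r a'" "?y a < ?y a'" for a a' p q
      by (rule sep[of U V]) (use that UV in auto)
    show "\<exists>k\<in>U. ?y a < ?y k \<and> ?y k < ?y a' \<and> p < ?r k \<and> ?l k < q"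
      if "a \<in> V" "a' \<in> V" "p < q" "?l a \<le> p" "q \<le> ?r a" "?l a' \<le> p" "q \<le> ?r a'" "?y a < ?y a'" for a a' p q
      by (rule sep[of V U]) (use that UV in auto)
  qed (use UV fin neq vis in auto)
  show False by (rule contradiction)
qed

end

lemma rep_complete_bipartite_lower_bound:
  assumes K: "K\<^bsub>n,n\<^esub> G" and rep: "bar_visibility_rep t G \<beta>"
  shows "0 < n \<Longrightarrow> n < 4 * t" and "n = 3 \<Longrightarrow> 2 \<le> t"
proof -
  interpret graph G using K by (simp add: complete_bipartite_digraph_def)
  obtain T own where "segment_rep t G T own" using rep_segments[OF rep] by auto
  then interpret segment_rep t G T own .
  show "0 < n \<Longrightarrow> n < 4 * t" using lower_bound[OF K] .
  show "n = 3 \<Longrightarrow> 2 \<le> t" using K33_lower_bound K by simp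
qed

section \<open>Representations with integer columns\<close>

text \<open>Bar \<open>i\<close> fills the unit columns from \<open>l i\<close> to
  \<open>r i - 1\<close>. As all ends are integers, what is seen depends only on the order of the
  bars in each unit column, so \<open>sep\<close> and \<open>touch\<close> are conditions on single
  columns.\<close>

lemma columns_rep:
  fixes l r h :: "'i \<Rightarrow> nat" and G :: "('a, 'b) pre_digraph"
  assumes fin: "finite I" and pos: "\<And>i. i \<in> I \<Longrightarrow> l i < r i"
    and same: "\<And>i j. i \<in> I \<Longrightarrow> j \<in> I \<Longrightarrow> i \<noteq> j \<Longrightarrow> h i = h j \<Longrightarrow> r i \<le> l j \<or> r j \<le> l i"
    and lab: "\<And>i. i \<in> I \<Longrightarrow> lab i \<in> verts G"
    and num: "\<And>w. w \<in> verts G \<Longrightarrow> card {i \<in> I. lab i = w} \<le> t"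
    and sym: "symmetric G"
    and sep: "\<And>i j x. i \<in> I \<Longrightarrow> j \<in> I \<Longrightarrow> lab i \<noteq> lab j \<Longrightarrow> \<not> lab i \<rightarrow>\<^bsub>G\<^esub> lab j \<Longrightarrow>
       l i \<le> x \<Longrightarrow> x < r i \<Longrightarrow> l j \<le> x \<Longrightarrow> x < r j \<Longrightarrow> h i < h j \<Longrightarrow>
       \<exists>k\<in>I. l k \<le> x \<and> x < r k \<and> h i < h k \<and> h k < h j"
    and touch: "\<And>u v. u \<rightarrow>\<^bsub>G\<^esub> v \<Longrightarrow> \<exists>i\<in>I. \<exists>j\<in>I. {lab i, lab j} = {u, v} \<and> (\<exists>x. l i \<le> x \<and> x < r i \<and> l j \<le> x \<and> x < r j \<and>
       h i < h j \<and> (\<forall>k\<in>I. l k \<le> x \<longrightarrow> x < r k \<longrightarrow> \<not> (h i < h k \<and> h k < h j)))"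
  shows "\<exists>\<beta>. bar_visibility_rep t G \<beta>"
proof -
  \<comment> \<open>The fraction makes bars on the same level, which may touch, disjoint.\<close>
  define seg where "seg i = (real (l i), real (r i), real (h i) + 1 / (2 + real (l i)))" for i
  have seg [simp]: "lf (seg i) = real (l i)" "rt (seg i) = real (r i)" "ht (seg i) = real (h i) + 1 / (2 + real (l i))" for i
    by (simp_all add: seg_def lf_def rt_def ht_def)
  have frac: "0 < 1 / (2 + real m)" "1 / (2 + real m) < 1" for m by (auto simp: field_simps)
  have ht_less: "ht (seg i) < ht (seg j)" if "h i < h j" for i j
  proof -
    have "real (h i) + 1 \<le> real (h j)" using that by linarith
    then show ?thesis using frac[of "l i"] frac[of "l j"] unfolding seg by linarith
  qed
  have ht_le: "h i \<le> h j" if "ht (seg i) \<le> ht (seg j)" for i j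
    using ht_less[of j i] that by force
  have ht_inj: "i = j" if ij: "i \<in> I" "j \<in> I" "ht (seg i) = ht (seg j)" for i j
  proof (rule ccontr)
    assume ne: "i \<noteq> j"
    have h: "h i = h j" using ht_le[of i j] ht_le[of j i] ij by simp
    then have "2 + real (l i) = 2 + real (l j)" using ij by (simp add: field_simps)
    then have "l i = l j" by simp
    then show False using same[OF ij(1,2) ne h] pos[OF ij(1)] pos[OF ij(2)] by simp
  qed
  define T where "T = seg ` I"
  have posT: "lf k < rt k" if "k \<in> T" for k using that pos by (auto simp: T_def)
  have inj: "inj_on seg I" by (rule inj_onI) (use ht_inj in metis)
  have disj: "disjnt (hbar (seg i)) (hbar (seg j))" if "i \<in> I" "j \<in> I" "i \<noteq> j" for i j
    using that ht_inj by (auto simp: disjnt_def hbar_def simp del: seg)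
  define \<beta> where "\<beta> w = hbar ` seg ` {i \<in> I. lab i = w}" for w
  have all: "(\<Union>w\<in>verts G. \<beta> w) = hbar ` T" unfolding \<beta>_def T_def using lab by blast
  have chan1: "\<exists>x. l i \<le> x \<and> x < r i \<and> l j \<le> x \<and> x < r j \<and> h i < h j \<and>
      (\<forall>k\<in>I. l k \<le> x \<longrightarrow> x < r k \<longrightarrow> \<not> (h i < h k \<and> h k < h j))"
    if ij: "i \<in> I" "j \<in> I" and c: "chan T (seg i) (seg j)" for i j
  proof -
    from c obtain a b where ab: "a < b" "real (l i) \<le> a" "b \<le> real (r i)" "real (l j) \<le> a" "b \<le> real (r j)" "ht (seg i) < ht (seg j)"
      and blk: "\<forall>k\<in>T - {seg i, seg j}. ht (seg i) < ht k \<and> ht k < ht (seg j) \<longrightarrow> rt k \<le> a \<or> b \<le> lf k"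
      unfolding chan_def by (elim exE conjE) (rule that; simp)
    \<comment> \<open>The unit column containing \<open>a\<close>; integer ends force both bars to
      cover all of it.\<close>
    define x where "x = nat \<lfloor>a\<rfloor>"
    have "0 \<le> a" using ab(2) of_nat_0_le_iff[of "l i"] by linarith
    then have x: "real x \<le> a" "a < real x + 1" unfolding x_def by (simp_all add: of_nat_floor)
    have xs: "l i \<le> x" "x < r i" "l j \<le> x" "x < r j" using x ab by linarith+
    have "i \<noteq> j" using ab(6) by auto
    then have "h i \<noteq> h j" using same[OF ij] xs by auto
    moreover have "h i \<le> h j" using ab(6) ht_le[of i j] by simp
    ultimately have "h i < h j" by simp
    moreover have "\<not> (h i < h k \<and> h k < h j)" if k: "k \<in> I" "l k \<le> x" "x < r k" for k
    proof
      assume hk: "h i < h k \<and> h k < h j"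
      then have "k \<noteq> i" "k \<noteq> j" by auto
      then have "seg k \<in> T - {seg i, seg j}" using k ij inj by (auto simp: T_def dest: inj_onD)
      then have "real (r k) \<le> a \<or> b \<le> real (l k)" using blk ht_less[of i k] ht_less[of k j] hk by force
      then show False using x ab(1) k by linarith
    qed
    ultimately show ?thesis using xs by blast
  qed
  have chan2: "chan T (seg i) (seg j)"
    if ij: "i \<in> I" "j \<in> I" and x: "l i \<le> x" "x < r i" "l j \<le> x" "x < r j" "h i < h j"
      and blk: "\<forall>k\<in>I. l k \<le> x \<longrightarrow> x < r k \<longrightarrow> \<not> (h i < h k \<and> h k < h j)" for i j x
    unfolding chan_def
  proof (rule exI[of _ "real x"], rule exI[of _ "real x + 1"], intro conjI ballI impI)
    fix k assume k: "k \<in> T - {seg i, seg j}" "ht (seg i) < ht k \<and> ht k < ht (seg j)"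
    then obtain k' where k': "k' \<in> I" "k = seg k'" "k' \<noteq> i" "k' \<noteq> j" by (auto simp: T_def)
    \<comment> \<open>A shifted height strictly between gives only weak inequalities of levels;
      equality would put two bars of one level into one column.\<close>
    have le: "h i \<le> h k'" "h k' \<le> h j" using ht_le[of i k'] ht_le[of k' j] k k' by auto
    have "\<not> (l k' \<le> x \<and> x < r k')"
    proof
      assume c: "l k' \<le> x \<and> x < r k'"
      then have "h i \<noteq> h k'" "h k' \<noteq> h j" using same[OF ij(1) k'(1)] same[OF k'(1) ij(2)] k' x by auto
      then show False using blk c k'(1) le by auto
    qed
    then show "rt k \<le> real x \<or> real x + 1 \<le> lf k" using k' by auto
  qed (use x ht_less in auto)
  have sees: "sees (hbar ` T) (hbar (seg i)) (hbar (seg j)) \<longleftrightarrow> chan T (seg i) (seg j) \<or> chan T (seg j) (seg i)"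
    if "i \<in> I" "j \<in> I" for i j
    by (rule sees_hbar[OF posT]) (use that in \<open>auto simp: T_def\<close>)
  have sym': "v \<rightarrow>\<^bsub>G\<^esub> u" if "u \<rightarrow>\<^bsub>G\<^esub> v" for u v using arcs_ends_symmetric[OF sym that] .
  have "bar_visibility_rep t G \<beta>"
    unfolding bar_visibility_rep_def all
  proof (intro conjI ballI impI)
    fix w assume w: "w \<in> verts G"
    show "finite (\<beta> w)" using fin by (simp add: \<beta>_def)
    have "card (\<beta> w) \<le> card {i \<in> I. lab i = w}"
      unfolding \<beta>_def image_image by (rule card_image_le) (use fin in simp)
    then show "card (\<beta> w) \<le> t" using num[OF w] by simp
    show "is_bar B" if "B \<in> \<beta> w" for B
    proof -
      from that obtain i where "i \<in> I" "B = hbar (seg i)" unfolding \<beta>_def by blast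
      then show ?thesis unfolding is_bar_hbar using pos by (intro exI[of _ "seg i"]) simp
    qed
    show "pairwise disjnt (\<beta> w)"
      unfolding pairwise_def \<beta>_def using disj by blast
  next
    fix u v B C assume "u \<in> verts G" "v \<in> verts G" "u \<noteq> v" "B \<in> \<beta> u" "C \<in> \<beta> v"
    then show "disjnt B C" using disj unfolding \<beta>_def by blast
  next
    fix u v assume uv: "u \<in> verts G" "v \<in> verts G" "u \<noteq> v"
    show "u \<rightarrow>\<^bsub>G\<^esub> v \<longleftrightarrow> (\<exists>B\<in>\<beta> u. \<exists>C\<in>\<beta> v. sees (hbar ` T) B C)"
    proof
      assume "u \<rightarrow>\<^bsub>G\<^esub> v"
      from touch[OF this] obtain i j x where ij: "i \<in> I" "j \<in> I" "{lab i, lab j} = {u, v}"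
        and x: "l i \<le> x" "x < r i" "l j \<le> x" "x < r j" "h i < h j"
          "\<forall>k\<in>I. l k \<le> x \<longrightarrow> x < r k \<longrightarrow> \<not> (h i < h k \<and> h k < h j)"
        by (elim bexE conjE exE) (rule that)
      have c: "chan T (seg i) (seg j)" by (rule chan2[OF ij(1,2) x])
      have "lab i = u \<and> lab j = v \<or> lab i = v \<and> lab j = u" using ij(3) by (auto simp: doubleton_eq_iff)
      then show "\<exists>B\<in>\<beta> u. \<exists>C\<in>\<beta> v. sees (hbar ` T) B C"
      proof
        assume "lab i = u \<and> lab j = v"
        then have "hbar (seg i) \<in> \<beta> u" "hbar (seg j) \<in> \<beta> v" using ij unfolding \<beta>_def by auto
        then show ?thesis using sees[OF ij(1,2)] c by blast
      next
        assume "lab i = v \<and> lab j = u"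
        then have "hbar (seg j) \<in> \<beta> u" "hbar (seg i) \<in> \<beta> v" using ij unfolding \<beta>_def by auto
        then show ?thesis using sees[OF ij(2,1)] c by blast
      qed
    next
      assume "\<exists>B\<in>\<beta> u. \<exists>C\<in>\<beta> v. sees (hbar ` T) B C"
      then obtain i j where ij: "i \<in> I" "j \<in> I" "lab i = u" "lab j = v" "sees (hbar ` T) (hbar (seg i)) (hbar (seg j))"
        unfolding \<beta>_def by blast
      have *: "lab i \<rightarrow>\<^bsub>G\<^esub> lab j" if "i \<in> I" "j \<in> I" "lab i \<noteq> lab j" "chan T (seg i) (seg j)" for i j
        using chan1[OF that(1,2,4)] sep[OF that(1,2,3)] by (metis (no_types, lifting))
      from ij(5) sees[OF ij(1,2)] have "chan T (seg i) (seg j) \<or> chan T (seg j) (seg i)" by simp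
      then show "u \<rightarrow>\<^bsub>G\<^esub> v"
        using *[of i j] *[of j i] ij uv sym' by metis
    qed
  qed
  then show ?thesis by blast
qed

section \<open>The picture of a block\<close>

text \<open>
  \<open>Bot\<close>, \<open>Top\<close>, \<open>P1\<close>, \<open>P2\<close>, \<open>Q1\<close>, \<open>Q2\<close> belong to the frame, \<open>U1\<close> to \<open>V4\<close> to the four vertices of the
  block on each side. \<open>SU12\<close> is the strip between \<open>V1\<close> and \<open>V2\<close>, \<open>SU34\<close> the one between \<open>V3\<close> and \<open>V4\<close>,
  \<open>SV12\<close> the one between \<open>U1\<close> and \<open>U2\<close>, and \<open>SV34\<close> the one between \<open>U3\<close> and \<open>U4\<close>.
\<close>

datatype cell = Bot | Top | P1 | P2 | Q1 | Q2 | U1 | U2 | U3 | U4 | V1 | V2 | V3 | V4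
  | SU12 nat | SU34 nat | SV12 nat | SV34 nat

fun upper :: "cell \<Rightarrow> bool" where
  "upper Bot = False" | "upper Top = True" | "upper P1 = True" | "upper P2 = True"
| "upper Q1 = False" | "upper Q2 = False"
| "upper U1 = True" | "upper U2 = True" | "upper U3 = True" | "upper U4 = True"
| "upper V1 = False" | "upper V2 = False" | "upper V3 = False" | "upper V4 = False"
| "upper (SU12 k) = True" | "upper (SU34 k) = True" | "upper (SV12 k) = False" | "upper (SV34 k) = False"

fun level :: "cell \<Rightarrow> nat" where
  "level Bot = 0" | "level Top = 11" | "level P1 = 1" | "level P2 = 1" | "level Q1 = 2" | "level Q2 = 2"
| "level V1 = 2" | "level U3 = 3" | "level V3 = 4" | "level U1 = 5" | "level U2 = 7" | "level V4 = 8"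
| "level U4 = 9" | "level V2 = 10"
| "level (SU12 k) = 6" | "level (SU34 k) = 6" | "level (SV12 k) = 6" | "level (SV34 k) = 6"

locale block =
  fixes p q :: nat
begin

text \<open>Besides the strips there are ten columns: 0 to 3 for the frame, and six in which a
  shifted end of a nested pair gives an extra sight.\<close>

definition W :: nat where "W = 10 + 2 * p + 2 * q"

text \<open>The pairs \<open>V1\<close>/\<open>V2\<close>, \<open>U3\<close>/\<open>U4\<close>,
  \<open>V3\<close>/\<open>V4\<close>, \<open>U1\<close>/\<open>U2\<close> are nested from outside
  to inside. In each inner pair the lower bar starts and ends one column before the upper one: at
  the left it sees the upper bar of the enclosing pair, and at the right the upper bar sees the
  lower one of the enclosing pair. So neighbouring pairs see each other in all four combinations, 12
  edges in total. Strips stand where the next inner pair has not begun or has ended.\<close>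

fun left :: "cell \<Rightarrow> nat" where
  "left Bot = 0" | "left Top = 0" | "left P1 = 1" | "left P2 = 3" | "left Q1 = 1" | "left Q2 = 2"
| "left V1 = 4" | "left V2 = 4" | "left U3 = 4" | "left U4 = 5" | "left V3 = 5 + q" | "left V4 = 6 + q"
| "left U1 = 6 + 2 * q" | "left U2 = 7 + 2 * q"
| "left (SV34 k) = 5 + k" | "left (SU34 k) = 6 + q + k" | "left (SV12 k) = 7 + 2 * q + k"
| "left (SU12 k) = 10 + 2 * q + p + k"

fun right :: "cell \<Rightarrow> nat" where
  "right Bot = W" | "right Top = W" | "right P1 = 3" | "right P2 = W" | "right Q1 = 2" | "right Q2 = 4"
| "right V1 = W" | "right V2 = W" | "right U3 = 9 + 2 * q + p" | "right U4 = 10 + 2 * q + p"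
| "right V3 = 8 + 2 * q + p" | "right V4 = 9 + 2 * q + p"
| "right U1 = 7 + 2 * q + p" | "right U2 = 8 + 2 * q + p"
| "right (SV34 k) = 6 + k" | "right (SU34 k) = 7 + q + k" | "right (SV12 k) = 8 + 2 * q + k"
| "right (SU12 k) = 11 + 2 * q + p + k"

fun valid :: "cell \<Rightarrow> bool" where
  "valid (SU12 k) \<longleftrightarrow> k < p" | "valid (SV12 k) \<longleftrightarrow> k < p" | "valid (SU34 k) \<longleftrightarrow> k < q" | "valid (SV34 k) \<longleftrightarrow> k < q"
| "valid _ \<longleftrightarrow> True"

text \<open>\<open>above a d\<close> is the bar directly above the bar \<open>a\<close> in column \<open>d\<close>.\<close>

fun above :: "cell \<Rightarrow> nat \<Rightarrow> cell" where
  "above Bot d = (if d = 0 then Top else if d < 3 then P1 else P2)"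
| "above P1 d = (if d < 2 then Q1 else Q2)"
| "above P2 d = (if d < 4 then Q2 else V1)"
| "above Q1 d = Top" | "above Q2 d = Top" | "above V2 d = Top" | "above Top d = Top"
| "above V1 d = (if d < 9 + 2 * q + p then U3 else if d < 10 + 2 * q + p then U4 else SU12 (d - (10 + 2 * q + p)))"
| "above U3 d = (if d < 5 then V2 else if d < 5 + q then SV34 (d - 5) else if d < 8 + 2 * q + p then V3 else V4)"
| "above V3 d = (if d < 6 + q then U4 else if d < 6 + 2 * q then SU34 (d - (6 + q))
     else if d < 7 + 2 * q + p then U1 else U2)"
| "above U1 d = (if d < 7 + 2 * q then V4 else SV12 (d - (7 + 2 * q)))"
| "above U2 d = V4" | "above V4 d = U4" | "above U4 d = V2"
| "above (SU12 k) d = V2" | "above (SV34 k) d = U4" | "above (SU34 k) d = V4" | "above (SV12 k) d = U2"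

lemma left_less_right: "valid a \<Longrightarrow> left a < right a"
  by (cases a) (auto simp: W_def)

lemma right_le: "valid a \<Longrightarrow> right a \<le> W"
  by (cases a) (auto simp: W_def)

lemma same_level:
  "valid a \<Longrightarrow> valid b \<Longrightarrow> a \<noteq> b \<Longrightarrow> level a = level b \<Longrightarrow> right a \<le> left b \<or> right b \<le> left a"
  by (cases a; cases b) (auto simp: W_def)

lemma above:
  assumes "valid a" "a \<noteq> Top" "left a \<le> d" "d < right a"
  shows "valid (above a d) \<and> left (above a d) \<le> d \<and> d < right (above a d) \<and> level a < level (above a d) \<and>
    upper (above a d) \<noteq> upper a"
  using assms by (cases a) (auto simp: W_def)

lemma above_least:
  assumes "valid a" "a \<noteq> Top" "left a \<le> d" "d < right a" "valid b" "left b \<le> d" "d < right b" "level a < level b"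
  shows "level (above a d) \<le> level b"
  using assms by (cases a; cases b) (auto simp: W_def)

end

section \<open>The whole picture\<close>

text \<open>
  \<open>In r b\<close> is the bar \<open>b\<close> of block \<open>r\<close>; \<open>Bot\<close> and \<open>Top\<close> are shared by all blocks and occur with \<open>r = 0\<close>.
  The other bars lie to the right of all blocks: two hubs \<open>HA\<close>, \<open>HB\<close> of one side, \<open>Ha\<close>, \<open>Hb\<close> of the
  other, and strips \<open>XU\<close> between \<open>Hb\<close> and \<open>Ha\<close> and \<open>XV\<close> between \<open>HA\<close> and \<open>HB\<close>.
\<close>

datatype bar = In nat cell | HA | HB | Ha | Hb | XU nat | XV nat

fun in_upper :: "bar \<Rightarrow> bool" where
  "in_upper (In r b) = upper b" | "in_upper HA = True" | "in_upper HB = True" | "in_upper Ha = False"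
| "in_upper Hb = False" | "in_upper (XU k) = True" | "in_upper (XV k) = False"

fun lev :: "bar \<Rightarrow> nat" where
  "lev (In r b) = level b" | "lev HA = 1" | "lev HB = 3" | "lev Ha = 9" | "lev Hb = 7" | "lev (XU k) = 8" | "lev (XV k) = 2"

fun cell_bar :: "nat \<Rightarrow> cell \<Rightarrow> bar" where
  "cell_bar r Bot = In 0 Bot" | "cell_bar r Top = In 0 Top" | "cell_bar r b = In r b"

lemma in_upper_cell [simp]: "in_upper (cell_bar r b) = upper b"
  by (cases b) auto

lemma lev_cell [simp]: "lev (cell_bar r b) = level b"
  by (cases b) auto

lemma cell_eq [simp]: "b \<noteq> Bot \<Longrightarrow> b \<noteq> Top \<Longrightarrow> cell_bar r b = In r b"
  by (cases b) auto

text \<open>\<open>s\<close> is the number of blocks and \<open>m\<close> the length of the strips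
  \<open>XU\<close> and \<open>XV\<close>. The assumption on \<open>p\<close> provides the strip bar
  that is prolonged into the right part.\<close>

locale layout = block p q for p q :: nat +
  fixes s m :: nat
  assumes s: "0 < s" and p: "0 < m \<Longrightarrow> 0 < p"
begin

text \<open>From \<open>s * W\<close> on, by columns: one with the prolonged strip bar below
  \<open>Hb\<close>, one with \<open>HA\<close> below \<open>Hb\<close>, \<open>m\<close> for
  \<open>XU\<close>, one where \<open>HA\<close> sees \<open>Ha\<close>, and \<open>m\<close> for
  \<open>XV\<close>.\<close>

fun lb :: "bar \<Rightarrow> nat" where
  "lb (In r b) = (if b = Bot \<or> b = Top then 0 else r * W + left b)"
| "lb HA = s * W + 1" | "lb HB = s * W + 3 + m" | "lb Ha = s * W + 2" | "lb Hb = s * W"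
| "lb (XU k) = s * W + 2 + k" | "lb (XV k) = s * W + 3 + m + k"

text \<open>The last strip bar of the last block is one column longer, so that it sees \<open>Hb\<close>.\<close>

fun rb :: "bar \<Rightarrow> nat" where
  "rb (In r b) = (if b = Bot \<or> b = Top then s * W + (if 0 < m then 3 + 2 * m else 0)
     else r * W + right b + (if 0 < m \<and> r = s - 1 \<and> b = SU12 (p - 1) then 1 else 0))"
| "rb HA = s * W + 3 + 2 * m" | "rb HB = s * W + 3 + 2 * m" | "rb Ha = s * W + 3 + 2 * m" | "rb Hb = s * W + 2 + m"
| "rb (XU k) = s * W + 3 + k" | "rb (XV k) = s * W + 4 + m + k"

fun ok :: "bar \<Rightarrow> bool" where
  "ok (In r b) \<longleftrightarrow> r < s \<and> valid b \<and> (b = Bot \<or> b = Top \<longrightarrow> r = 0)"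
| "ok (XU k) \<longleftrightarrow> 0 < m \<and> k < m" | "ok (XV k) \<longleftrightarrow> 0 < m \<and> k < m" | "ok _ \<longleftrightarrow> 0 < m"

definition cov :: "bar \<Rightarrow> nat \<Rightarrow> bool" where
  "cov i x \<longleftrightarrow> ok i \<and> lb i \<le> x \<and> x < rb i"

definition touches :: "bar \<Rightarrow> bar \<Rightarrow> bool" where
  "touches i j \<longleftrightarrow> (\<exists>x. cov i x \<and> cov j x \<and> lev i < lev j \<and> (\<forall>k. cov k x \<longrightarrow> \<not> (lev i < lev k \<and> lev k < lev j)))"

lemma finite_ok: "finite {i. ok i}"
proof -
  have "{b. valid b} \<subseteq> {Bot, Top, P1, P2, Q1, Q2, U1, U2, U3, U4, V1, V2, V3, V4}
      \<union> SU12 ` {..<p} \<union> SU34 ` {..<q} \<union> SV12 ` {..<p} \<union> SV34 ` {..<q}" (is "_ \<subseteq> ?C")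
  proof
    fix b assume "b \<in> {b. valid b}"
    then show "b \<in> ?C" by (cases b) auto
  qed
  then have f: "finite {b. valid b}" by (rule finite_subset) simp
  have "{i. ok i} \<subseteq> (\<lambda>(r, b). In r b) ` ({..<s} \<times> {b. valid b}) \<union> {HA, HB, Ha, Hb} \<union> XU ` {..<m} \<union> XV ` {..<m}"
    (is "_ \<subseteq> ?D")
  proof
    fix i assume "i \<in> {i. ok i}"
    then show "i \<in> ?D" by (cases i) auto
  qed
  then show ?thesis by (rule finite_subset) (use f in simp)
qed

lemma mult_less_block: "a < b \<Longrightarrow> a * W + W \<le> b * W"
  using mult_le_mono1[of "Suc a" b W] by simp

text \<open>The prolonged strip bar leaves its block only to the right of all blocks, so no block
  contains a bar of another one except the shared \<open>Bot\<close> and \<open>Top\<close>.\<close>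

lemma cov_cell:
  assumes "r < s" "d < W"
  shows "cov i (r * W + d) \<longleftrightarrow> (\<exists>b. i = cell_bar r b \<and> valid b \<and> left b \<le> d \<and> d < right b)"
proof
  have rW: "r * W + W \<le> s * W" using assms mult_less_block by blast
  assume c: "cov i (r * W + d)"
  then obtain r' b where i: "i = In r' b" using rW assms by (cases i) (auto simp: cov_def)
  show "\<exists>b. i = cell_bar r b \<and> valid b \<and> left b \<le> d \<and> d < right b"
  proof (cases "b = Bot \<or> b = Top")
    case True
    then show ?thesis using c assms i by (intro exI[of _ b]) (auto simp: cov_def)
  next
    case False
    define e where "e = (if 0 < m \<and> r' = s - 1 \<and> b = SU12 (p - 1) then 1 else 0 :: nat)"
    have v: "valid b" "r' < s" "r' * W + left b \<le> r * W + d" "r * W + d < r' * W + right b + e"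
      using c i False by (auto simp: cov_def e_def split: if_splits)
    have rb: "right b \<le> W" using v right_le by blast
    have "\<not> r' < r"
    proof
      assume r: "r' < r"
      then have "e = 0" using assms by (auto simp: e_def)
      then show False using v rb mult_less_block[OF r] by linarith
    qed
    moreover have "\<not> r < r'"
    proof
      assume r: "r < r'"
      then show False using v assms mult_less_block[OF r] by linarith
    qed
    ultimately have r: "r' = r" by simp
    have "e > 0 \<Longrightarrow> right b = W" using p by (auto simp: e_def W_def split: if_splits)
    moreover have "e \<le> 1" by (simp add: e_def)
    ultimately have "d < right b" using v r assms by (cases "e = 0") auto
    then show ?thesis using False i r v by (intro exI[of _ b]) auto
  qed
next
  have rW: "r * W + W \<le> s * W" using assms mult_less_block by blast
  assume "\<exists>b. i = cell_bar r b \<and> valid b \<and> left b \<le> d \<and> d < right b"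
  then obtain b where "i = cell_bar r b" "valid b" "left b \<le> d" "d < right b" by blast
  then show "cov i (r * W + d)"
    using assms rW s by (cases "b = Bot \<or> b = Top") (auto simp: cov_def)
qed

lemma cov_right_In:
  "cov (In r b) (s * W + d) \<longleftrightarrow>
    0 < m \<and> (r = 0 \<and> (b = Bot \<or> b = Top) \<and> d < 3 + 2 * m \<or> r = s - 1 \<and> b = SU12 (p - 1) \<and> d = 0)"
proof (cases "b = Bot \<or> b = Top")
  case True
  then show ?thesis using s by (auto simp: cov_def)
next
  case False
  show ?thesis
  proof
    assume "cov (In r b) (s * W + d)"
    then have c: "r < s" "valid b" "s * W + d < r * W + right b + (if 0 < m \<and> r = s - 1 \<and> b = SU12 (p - 1) then 1 else 0)"
      using False by (auto simp: cov_def)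
    have "r * W + right b \<le> s * W" using mult_less_block[OF c(1)] right_le[OF c(2)] by linarith
    then show "0 < m \<and> (r = 0 \<and> (b = Bot \<or> b = Top) \<and> d < 3 + 2 * m \<or> r = s - 1 \<and> b = SU12 (p - 1) \<and> d = 0)"
      using c(3) by (auto split: if_splits)
  next
    assume "0 < m \<and> (r = 0 \<and> (b = Bot \<or> b = Top) \<and> d < 3 + 2 * m \<or> r = s - 1 \<and> b = SU12 (p - 1) \<and> d = 0)"
    with False have b: "0 < m" "r = s - 1" "b = SU12 (p - 1)" "d = 0" by auto
    have "s = Suc (s - 1)" using s by simp
    then have "s * W = (s - 1) * W + W" by (metis add.commute mult_Suc)
    moreover have "right (SU12 (p - 1)) = W" "left (SU12 (p - 1)) < W" "valid (SU12 (p - 1))"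
      using p b by (auto simp: W_def)
    ultimately show "cov (In r b) (s * W + d)" using b s by (simp add: cov_def)
  qed
qed

text \<open>The counterpart of \<open>above\<close> for the columns to the right of all blocks.\<close>

fun above_right :: "bar \<Rightarrow> nat \<Rightarrow> bar" where
  "above_right (In r b) d = (if b = Bot then if d = 0 then In (s - 1) (SU12 (p - 1)) else HA else Hb)"
| "above_right HA d = (if d < 2 + m then Hb else if d = 2 + m then Ha else XV (d - (3 + m)))"
| "above_right Hb d = (if d < 2 then In 0 Top else XU (d - 2))"
| "above_right (XU k) d = Ha" | "above_right Ha d = In 0 Top" | "above_right (XV k) d = HB" | "above_right HB d = Ha"

lemma above_right:
  assumes "cov i (s * W + d)" "i \<noteq> In 0 Top"
  shows "cov (above_right i d) (s * W + d) \<and> lev i < lev (above_right i d) \<and> in_upper (above_right i d) \<noteq> in_upper i"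
proof (cases i)
  case (In r b)
  have S: "cov (In (s - 1) (SU12 (p - 1))) (s * W)" if "0 < m"
    using cov_right_In[of "s - 1" "SU12 (p - 1)" 0] that by simp
  from In assms consider "0 < m" "i = In 0 Bot" "d = 0" | "0 < m" "i = In 0 Bot" "0 < d" "d < 3 + 2 * m"
    | "0 < m" "i = In (s - 1) (SU12 (p - 1))" "d = 0"
    by (auto simp: cov_right_In)
  then show ?thesis
  proof cases
    case 1
    then show ?thesis using S by simp
  qed (auto simp: cov_def)
qed (use assms s p in \<open>auto simp: cov_right_In\<close>, (auto simp: cov_def)?)

lemma above_right_least:
  assumes "cov i (s * W + d)" "i \<noteq> In 0 Top" "cov j (s * W + d)" "lev i < lev j"
  shows "lev (above_right i d) \<le> lev j"
  using assms s by (cases i; cases j; simp add: cov_right_In; (elim conjE disjE)?; simp add: cov_def split: if_splits)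

definition next_bar :: "bar \<Rightarrow> nat \<Rightarrow> bar" where
  "next_bar i x = (if x < s * W then case i of In r b \<Rightarrow> cell_bar (x div W) (above b (x mod W)) | _ \<Rightarrow> i
     else above_right i (x - s * W))"

lemma W_pos: "0 < W"
  by (simp add: W_def)

lemma next_bar_cell:
  assumes "r < s" "d < W"
  shows "next_bar (cell_bar r b) (r * W + d) = cell_bar r (above b d)"
proof -
  have "r * W + d < s * W" using mult_less_block[OF assms(1)] assms(2) by linarith
  moreover have "(r * W + d) div W = r" "(r * W + d) mod W = d" using assms by auto
  ultimately show ?thesis by (cases b) (auto simp: next_bar_def)
qed

lemma next_bar:
  assumes "cov i x" "i \<noteq> In 0 Top"
  shows "cov (next_bar i x) x \<and> lev i < lev (next_bar i x) \<and> in_upper (next_bar i x) \<noteq> in_upper i \<and>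
    (\<forall>j. cov j x \<longrightarrow> lev i < lev j \<longrightarrow> lev (next_bar i x) \<le> lev j)"
proof (cases "x < s * W")
  case True
  define r d where "r = x div W" and "d = x mod W"
  have x: "x = r * W + d" "d < W"
    using W_pos by (simp_all only: r_def d_def div_mult_mod_eq mod_less_divisor)
  have r: "r < s" using True by (simp add: r_def less_mult_imp_div_less)
  obtain b where b: "i = cell_bar r b" "valid b" "left b \<le> d" "d < right b"
    using assms(1) unfolding x(1) cov_cell[OF r x(2)] by blast
  then have nT: "b \<noteq> Top" using assms(2) by auto
  have n: "next_bar i x = cell_bar r (above b d)" unfolding b(1) x(1) by (rule next_bar_cell[OF r x(2)])
  note ab = above[OF b(2) nT b(3,4)]
  show ?thesis
    unfolding n
  proof (intro conjI allI impI)
    show "cov (cell_bar r (above b d)) x" unfolding x(1) cov_cell[OF r x(2)] using ab by blast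
    fix j assume j: "cov j x" "lev i < lev j"
    then obtain c where c: "j = cell_bar r c" "valid c" "left c \<le> d" "d < right c"
      unfolding x(1) cov_cell[OF r x(2)] by blast
    then show "lev (cell_bar r (above b d)) \<le> lev j"
      using above_least[OF b(2) nT b(3,4) c(2-4)] j(2) b(1) by simp
  qed (use ab b in auto)
next
  case False
  define d where "d = x - s * W"
  have x: "x = s * W + d" using False by (simp add: d_def)
  have n: "next_bar i x = above_right i d" using False by (simp add: next_bar_def d_def)
  show ?thesis
    unfolding n using above_right above_right_least assms unfolding x by blast
qed

text \<open>Only \<open>Bot\<close>, \<open>Top\<close> and a strip bar can extend from the blocks
  into the right part, and their levels 0, 11 and 6 do not occur among the bars placed
  there.\<close>

lemma same_lev:
  assumes ij: "ok i" "ok j" "i \<noteq> j" "lev i = lev j"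
  shows "rb i \<le> lb j \<or> rb j \<le> lb i"
proof -
  have In_le: "rb (In r b) \<le> s * W" if "ok (In r b)" "b \<noteq> Bot" "b \<noteq> Top" "level b \<noteq> 6" for r b
  proof -
    have "r * W + right b \<le> s * W" using mult_less_block[of r s] right_le[of b] that by fastforce
    then show ?thesis using that by auto
  qed
  have ns: "rb j \<le> lb i" if "ok i" "ok j" "lev i = lev j" "\<not> (\<exists>r b. i = In r b)" "j = In r b" for i j r b
  proof -
    have "b \<noteq> Bot" "b \<noteq> Top" "level b \<noteq> 6" using that by (cases i; auto)+
    then have "rb j \<le> s * W" using In_le[of r b] that by blast
    moreover have "s * W \<le> lb i" using that by (cases i) auto
    ultimately show ?thesis by linarith
  qed
  consider r b r' b' where "i = In r b" "j = In r' b'" | r b where "\<not> (\<exists>r b. i = In r b)" "j = In r b"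
    | r b where "\<not> (\<exists>r b. j = In r b)" "i = In r b" | "\<not> (\<exists>r b. i = In r b)" "\<not> (\<exists>r b. j = In r b)" by metis
  then show ?thesis
  proof cases
    case (1 r b r' b')
    have no: "b \<noteq> Bot" "b \<noteq> Top" "b' \<noteq> Bot" "b' \<noteq> Top"
      using 1 ij by (cases b; cases b'; auto)+
    have sep: "rb (In r b) \<le> lb (In r' b')"
      if "r < r'" "ok (In r b)" "ok (In r' b')" "b \<noteq> Bot" "b \<noteq> Top" "b' \<noteq> Bot" "b' \<noteq> Top" for r r' b b'
      using that mult_less_block[OF that(1)] right_le[of b] by auto
    show ?thesis
    proof (cases "r = r'")
      case True
      then have "b \<noteq> b'" using 1 ij by auto
      then have "right b \<le> left b' \<or> right b' \<le> left b" using same_level[of b b'] 1 ij by auto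
      moreover have "left c < W" if "valid c" for c using left_less_right[OF that] right_le[OF that] by simp
      moreover have "right (SU12 (p - 1)) = W" if "0 < m" using p[OF that] by (simp add: W_def)
      ultimately show ?thesis using 1 ij no True by (force split: if_splits)
    next
      case False
      then have "r < r' \<or> r' < r" by auto
      then show ?thesis using sep[of r r' b b'] sep[of r' r b' b] 1 ij no by blast
    qed
  next
    case 2
    then show ?thesis using ns ij by blast
  next
    case 3
    then show ?thesis using ns[of j i] ij by auto
  next
    case 4
    then show ?thesis using ij by (cases i; cases j) auto
  qed
qed

lemma lb_less_rb: "ok i \<Longrightarrow> lb i < rb i"
  using s W_pos left_less_right by (cases i) (auto simp: trans_less_add1)

lemma touches_next: "cov i x \<Longrightarrow> i \<noteq> In 0 Top \<Longrightarrow> touches i (next_bar i x)"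
  unfolding touches_def using next_bar[of i x] by (intro exI[of _ x]) force

text \<open>Sides alternate along a column, so the bar directly above \<open>i\<close> differs from
  \<open>j\<close>, and by \<open>same_lev\<close> it is not on the level of \<open>j\<close>
  either.\<close>

lemma separated:
  assumes "cov i x" "cov j x" "in_upper i = in_upper j" "lev i < lev j"
  shows "\<exists>k. cov k x \<and> lev i < lev k \<and> lev k < lev j"
proof -
  have "i \<noteq> In 0 Top"
  proof
    assume "i = In 0 Top"
    then have "lev j > 11" using assms by simp
    moreover have "level b \<le> 11" for b by (cases b) auto
    then have "lev j \<le> 11" by (cases j) auto
    ultimately show False by simp
  qed
  note n = next_bar[OF assms(1) this]
  have ne: "next_bar i x \<noteq> j" using n assms(3) by auto
  have "lev (next_bar i x) \<noteq> lev j"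
    using same_lev[OF _ _ ne] n assms(2) unfolding cov_def by fastforce
  then show ?thesis using n assms by (intro exI[of _ "next_bar i x"]) force
qed

lemma touches_cell:
  assumes "r < s" "valid a" "a \<noteq> Top" "left a \<le> d" "d < right a" "above a d = b"
  shows "touches (cell_bar r a) (cell_bar r b)"
proof -
  have d: "d < W" using right_le[OF assms(2)] assms by simp
  have "cov (cell_bar r a) (r * W + d)" unfolding cov_cell[OF assms(1) d] using assms by blast
  moreover have "cell_bar r a \<noteq> In 0 Top" using assms(3) by (cases a) auto
  ultimately have "touches (cell_bar r a) (next_bar (cell_bar r a) (r * W + d))" by (rule touches_next)
  then show ?thesis unfolding next_bar_cell[OF assms(1) d] assms(6) .
qed

lemma touches_right:
  assumes "cov i (s * W + d)" "i \<noteq> In 0 Top" "above_right i d = j"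
  shows "touches i j"
  using touches_next[OF assms(1,2)] assms(3) by (simp add: next_bar_def)

end

section \<open>Assignment of vertices\<close>

datatype vtx = Blk nat nat | Hub nat

text \<open>In block \<open>r\<close> the strips contain two vertices of every other block; \<open>other r k\<close> is the block of the
  \<open>k\<close>-th strip entry and \<open>slot r r' e\<close> is the entry of vertex \<open>e\<close> of block \<open>r'\<close>.\<close>

definition other :: "nat \<Rightarrow> nat \<Rightarrow> nat" where
  "other r k = (if k div 2 < r then k div 2 else Suc (k div 2))"

definition slot :: "nat \<Rightarrow> nat \<Rightarrow> nat \<Rightarrow> nat" where
  "slot r r' e = 2 * (if r' < r then r' else r' - 1) + e"

text \<open>The edge from vertex \<open>i\<close> on the upper side of one block to vertex
  \<open>j\<close> on the lower side of another is drawn in the block of \<open>j\<close> if both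
  indices are below 2 or both are not, and in the block of \<open>i\<close> otherwise. Thus each
  vertex has one strip bar in every other block; the hubs come last in the strips. Without hubs the
  outermost bars go to a vertex with no other bar in the frame.\<close>

fun cell_label :: "nat \<Rightarrow> nat \<Rightarrow> nat \<Rightarrow> cell \<Rightarrow> vtx" where
  "cell_label s h r Bot = (if h = 0 then Blk 0 2 else Hub 0)"
| "cell_label s h r Top = (if h = 0 then Blk 0 2 else Hub 0)"
| "cell_label s h r P1 = Blk r 0" | "cell_label s h r P2 = Blk r 1" | "cell_label s h r Q1 = Blk r 0" | "cell_label s h r Q2 = Blk r 1"
| "cell_label s h r U1 = Blk r 0" | "cell_label s h r U2 = Blk r 1" | "cell_label s h r U3 = Blk r 2" | "cell_label s h r U4 = Blk r 3"
| "cell_label s h r V1 = Blk r 0" | "cell_label s h r V2 = Blk r 1" | "cell_label s h r V3 = Blk r 2" | "cell_label s h r V4 = Blk r 3"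
| "cell_label s h r (SU12 k) = (if k < 2 * (s - 1) then Blk (other r k) (k mod 2) else Hub (1 + (k - 2 * (s - 1))))"
| "cell_label s h r (SU34 k) = (if k < 2 * (s - 1) then Blk (other r k) (2 + k mod 2) else Hub 0)"
| "cell_label s h r (SV12 k) = (if k < 2 * (s - 1) then Blk (other r k) (2 + k mod 2) else Hub (1 + (k - 2 * (s - 1))))"
| "cell_label s h r (SV34 k) = (if k < 2 * (s - 1) then Blk (other r k) (k mod 2) else Hub 0)"

text \<open>A strip must run between bars of two hubs. For \<open>h = 3\<close> these are hubs 1 and
  2, while hub 0 enters the strips of the blocks; for \<open>h = 2\<close> hub 0 has to be the
  second of them.\<close>

fun label :: "nat \<Rightarrow> nat \<Rightarrow> bar \<Rightarrow> vtx" where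
  "label s h (In r b) = cell_label s h r b"
| "label s h HA = Hub 1" | "label s h Ha = Hub 1"
| "label s h HB = (if h = 3 then Hub 2 else Hub 0)" | "label s h Hb = (if h = 3 then Hub 2 else Hub 0)"
| "label s h (XU k) = Blk (k div 2) (2 + k mod 2)" | "label s h (XV k) = Blk (k div 2) (2 + k mod 2)"

text \<open>Every vertex has at most one bar in each of the \<open>s + 1\<close> pictures, where picture \<open>r < s\<close> is the
  inner part of block \<open>r\<close> and picture \<open>s\<close> is the frame; if \<open>h = 2\<close> then \<open>HB\<close> and \<open>Hb\<close> replace the
  bars that the hub 0 does not have in the blocks.\<close>

fun picture :: "nat \<Rightarrow> nat \<Rightarrow> bar \<Rightarrow> nat" where
  "picture s h (In r b) = (if b \<in> {Bot, Top, P1, P2, Q1, Q2} then s else r)"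
| "picture s h HB = (if h = 3 then s else 0)" | "picture s h Hb = (if h = 3 then s else 0)"
| "picture s h _ = s"

text \<open>A left inverse that recovers a bar of the upper side from its vertex and its picture; at
  arguments without such a bar the value is arbitrary.\<close>

fun upper_bar :: "nat \<Rightarrow> nat \<Rightarrow> vtx \<Rightarrow> nat \<Rightarrow> bar" where
  "upper_bar s h (Blk r i) g =
     (if g = s then if i = 0 then In r P1 else if i = 1 then In r P2 else if h = 0 then In 0 Top else XU (2 * r + (i - 2))
      else if g = r then In r (if i = 0 then U1 else if i = 1 then U2 else if i = 2 then U3 else U4)
      else if i < 2 then In g (SU12 (slot g r i)) else In g (SU34 (slot g r (i - 2))))"
| "upper_bar s h (Hub j) g =
     (if j = 0 then if g = s then In 0 Top else if h = 2 then HB else In g (SU34 (2 * (s - 1)))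
      else if g = s then if j = 1 then HA else HB else In g (SU12 (2 * (s - 1) + (j - 1))))"

fun lower_bar :: "nat \<Rightarrow> nat \<Rightarrow> vtx \<Rightarrow> nat \<Rightarrow> bar" where
  "lower_bar s h (Blk r i) g =
     (if g = s then if i = 0 then In r Q1 else if i = 1 then In r Q2 else if h = 0 then In 0 Bot else XV (2 * r + (i - 2))
      else if g = r then In r (if i = 0 then V1 else if i = 1 then V2 else if i = 2 then V3 else V4)
      else if i < 2 then In g (SV34 (slot g r i)) else In g (SV12 (slot g r (i - 2))))"
| "lower_bar s h (Hub j) g =
     (if j = 0 then if g = s then In 0 Bot else if h = 2 then Hb else In g (SV34 (2 * (s - 1)))
      else if g = s then if j = 1 then Ha else Hb else In g (SV12 (2 * (s - 1) + (j - 1))))"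

text \<open>The condition \<open>ok\<close> with the strip lengths written out in \<open>s\<close>
  and \<open>h\<close>, which allows a case analysis on the shape of the bar outside the
  locale.\<close>

fun plain_ok :: "nat \<Rightarrow> nat \<Rightarrow> bar \<Rightarrow> bool" where
  "plain_ok s h (In r (SU12 k)) \<longleftrightarrow> r < s \<and> k < 2 * (s - 1) + (h - 1)"
| "plain_ok s h (In r (SV12 k)) \<longleftrightarrow> r < s \<and> k < 2 * (s - 1) + (h - 1)"
| "plain_ok s h (In r (SU34 k)) \<longleftrightarrow> r < s \<and> k < 2 * (s - 1) + (if h = 1 \<or> h = 3 then 1 else 0)"
| "plain_ok s h (In r (SV34 k)) \<longleftrightarrow> r < s \<and> k < 2 * (s - 1) + (if h = 1 \<or> h = 3 then 1 else 0)"
| "plain_ok s h (In r b) \<longleftrightarrow> r < s \<and> (b = Bot \<or> b = Top \<longrightarrow> r = 0)"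
| "plain_ok s h (XU k) \<longleftrightarrow> 2 \<le> h \<and> k < 2 * s" | "plain_ok s h (XV k) \<longleftrightarrow> 2 \<le> h \<and> k < 2 * s"
| "plain_ok s h _ \<longleftrightarrow> 2 \<le> h"

section \<open>Strip entries, labels and pictures\<close>

lemma slot_other: "slot r (other r k) (k mod 2) = k"
  by (simp add: slot_def other_def)

lemma other_neq: "other r k \<noteq> r"
  by (simp add: other_def)

lemma other_less: "k < 2 * (s - 1) \<Longrightarrow> other r k < s"
  by (auto simp: other_def)

lemma slot_less: "r < s \<Longrightarrow> r' < s \<Longrightarrow> r' \<noteq> r \<Longrightarrow> e < 2 \<Longrightarrow> slot r r' e < 2 * (s - 1)"
  by (auto simp: slot_def)

lemma other_slot: "r' \<noteq> r \<Longrightarrow> e < 2 \<Longrightarrow> other r (slot r r' e) = r'"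
  by (auto simp: slot_def other_def)

lemma slot_mod: "e < 2 \<Longrightarrow> slot r r' e mod 2 = e"
  by (auto simp: slot_def)

lemma picture_le: "plain_ok s h i \<Longrightarrow> picture s h i \<le> s"
  by (cases "(s, h, i)" rule: plain_ok.cases) auto

text \<open>For the count: this makes \<open>picture\<close> injective on the bars of one vertex,
  which therefore has at most \<open>s + 1\<close> bars.\<close>

lemma bar_of_picture:
  assumes "plain_ok s h i" "h \<le> 3" "0 < s"
  shows "(if in_upper i then upper_bar else lower_bar) s h (label s h i) (picture s h i) = i"
  using assms
  by (cases "(s, h, i)" rule: plain_ok.cases)
    (auto simp: slot_other other_neq other_neq[symmetric] split: if_splits)

text \<open>A model of one side of the graph; both sides are identified with it.\<close>

definition vtxs :: "nat \<Rightarrow> nat \<Rightarrow> vtx set" where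
  "vtxs s h = (\<lambda>(r, i). Blk r i) ` ({..<s} \<times> {..<4}) \<union> Hub ` {..<h}"

lemma card_vtxs: "card (vtxs s h) = 4 * s + h"
proof -
  have "card ((\<lambda>(r, i). Blk r i) ` ({..<s} \<times> {..<4})) = card ({..<s} \<times> {..<4::nat})"
    by (rule card_image) (auto simp: inj_on_def)
  moreover have "card (Hub ` {..<h}) = h" by (simp add: card_image inj_on_def)
  ultimately show ?thesis unfolding vtxs_def by (subst card_Un_disjoint) auto
qed

lemma Blk_vtxs [simp]: "Blk r i \<in> vtxs s h \<longleftrightarrow> r < s \<and> i < 4"
  and Hub_vtxs [simp]: "Hub j \<in> vtxs s h \<longleftrightarrow> j < h"
  by (auto simp: vtxs_def)

lemma label_vtxs: "plain_ok s h i \<Longrightarrow> 0 < s \<Longrightarrow> h \<le> 3 \<Longrightarrow> label s h i \<in> vtxs s h"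
  by (cases "(s, h, i)" rule: plain_ok.cases) (auto simp: other_less split: if_splits)

text \<open>Strips have two entries for each of the other \<open>s - 1\<close> blocks. Hubs other
  than hub 0 add \<open>h - 1\<close> entries to the strips of length \<open>p\<close>, truncated to
  0 for \<open>h = 0\<close>; hub 0 adds one to those of length \<open>q\<close> if \<open>h\<close>
  is odd. \<open>XU\<close> and \<open>XV\<close> hold two vertices of each block.\<close>

locale labelled = layout p q s m for p q s m :: nat +
  fixes h :: nat
  assumes h: "h \<le> 3" and p_eq: "p = 2 * (s - 1) + (h - 1)"
    and q_eq: "q = 2 * (s - 1) + (if h = 1 \<or> h = 3 then 1 else 0)"
    and m_eq: "m = (if 2 \<le> h then 2 * s else 0)"
begin

lemma less_p: "k < p \<longleftrightarrow> k < 2 * (s - 1) + (h - 1)"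
  and less_q: "k < q \<longleftrightarrow> k < 2 * (s - 1) + (if h = 1 \<or> h = 3 then 1 else 0)"
  and less_m: "k < m \<longleftrightarrow> 2 \<le> h \<and> k < 2 * s"
  by (simp_all only: p_eq q_eq m_eq) auto

lemma plain_ok:
  assumes "ok i"
  shows "plain_ok s h i"
proof (cases i)
  case (In r b)
  then have "r < s" "valid b" "b = Bot \<or> b = Top \<longrightarrow> r = 0" using assms by simp_all
  then show ?thesis unfolding In by (cases b) (auto simp: less_p less_q simp del: One_nat_def)
qed (use assms in \<open>auto simp: less_m\<close>)

lemma card_label: "card {i \<in> {i. ok i}. label s h i = v \<and> in_upper i = c} \<le> s + 1"
proof -
  let ?S = "{i \<in> {i. ok i}. label s h i = v \<and> in_upper i = c}"
  have "inj_on (picture s h) ?S"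
  proof (rule inj_onI)
    fix i j assume "i \<in> ?S" "j \<in> ?S" "picture s h i = picture s h j"
    then show "i = j"
      using bar_of_picture[OF plain_ok h s, of i] bar_of_picture[OF plain_ok h s, of j] by simp
  qed
  moreover have "picture s h ` ?S \<subseteq> {..s}" using picture_le plain_ok by auto
  ultimately have "card ?S \<le> card {..s}" by (intro card_inj_on_le) auto
  then show ?thesis by simp
qed

text \<open>\<open>u\<close> stands for a vertex of the upper side and \<open>v\<close> for one of
  the lower side, so \<open>linked u u\<close> is a genuine edge.\<close>

definition linked :: "vtx \<Rightarrow> vtx \<Rightarrow> bool" where
  "linked u v \<longleftrightarrow> (\<exists>i j. in_upper i \<and> \<not> in_upper j \<and> label s h i = u \<and> label s h j = v \<and> (touches i j \<or> touches j i))"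

lemma linked_upper: "touches i j \<Longrightarrow> in_upper i \<Longrightarrow> \<not> in_upper j \<Longrightarrow> label s h i = u \<Longrightarrow> label s h j = v \<Longrightarrow> linked u v"
  unfolding linked_def by blast

lemma linked_lower: "touches j i \<Longrightarrow> in_upper i \<Longrightarrow> \<not> in_upper j \<Longrightarrow> label s h i = u \<Longrightarrow> label s h j = v \<Longrightarrow> linked u v"
  unfolding linked_def by blast

lemma label_cell: "label s h (cell_bar r b) = cell_label s h r b"
  by (cases b) auto

lemma linked_cell:
  assumes "r < s" "valid a" "a \<noteq> Top" "left a \<le> d" "d < right a"
  shows "upper a \<Longrightarrow> linked (cell_label s h r a) (cell_label s h r (above a d))"
    and "\<not> upper a \<Longrightarrow> linked (cell_label s h r (above a d)) (cell_label s h r a)"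
proof -
  have t: "touches (cell_bar r a) (cell_bar r (above a d))" using touches_cell[OF assms] by blast
  have u: "upper (above a d) \<noteq> upper a" using above[OF assms(2-5)] by blast
  show "upper a \<Longrightarrow> linked (cell_label s h r a) (cell_label s h r (above a d))"
    using linked_upper[OF t] u label_cell by simp
  show "\<not> upper a \<Longrightarrow> linked (cell_label s h r (above a d)) (cell_label s h r a)"
    using linked_lower[OF t] u label_cell by simp
qed

lemma linked_block:
  assumes r: "r < s" and ij: "i < 4" "j < 4"
  shows "linked (Blk r i) (Blk r j)"
proof -
  have "linked (Blk r 0) (Blk r 0)" using linked_cell(1)[of r P1 1] r by simp
  moreover have "linked (Blk r 0) (Blk r 1)" using linked_cell(1)[of r P1 2] r by simp
  moreover have "linked (Blk r 1) (Blk r 1)" using linked_cell(1)[of r P2 3] r by (simp add: W_def)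
  moreover have "linked (Blk r 1) (Blk r 0)" using linked_cell(1)[of r P2 4] r by (simp add: W_def)
  moreover have "linked (Blk r 2) (Blk r 0)" using linked_cell(2)[of r V1 4] r by (simp add: W_def)
  moreover have "linked (Blk r 2) (Blk r 1)" using linked_cell(1)[of r U3 4] r by simp
  moreover have "linked (Blk r 2) (Blk r 2)" using linked_cell(1)[of r U3 "5 + q"] r by simp
  moreover have "linked (Blk r 2) (Blk r 3)" using linked_cell(1)[of r U3 "8 + 2 * q + p"] r by simp
  moreover have "linked (Blk r 3) (Blk r 0)" using linked_cell(2)[of r V1 "9 + 2 * q + p"] r by (simp add: W_def)
  moreover have "linked (Blk r 3) (Blk r 1)" using linked_cell(1)[of r U4 5] r by simp
  moreover have "linked (Blk r 3) (Blk r 2)" using linked_cell(2)[of r V3 "5 + q"] r by simp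
  moreover have "linked (Blk r 3) (Blk r 3)" using linked_cell(2)[of r V4 "6 + q"] r by simp
  moreover have "linked (Blk r 0) (Blk r 2)" using linked_cell(2)[of r V3 "6 + 2 * q"] r by simp
  moreover have "linked (Blk r 0) (Blk r 3)" using linked_cell(1)[of r U1 "6 + 2 * q"] r by simp
  moreover have "linked (Blk r 1) (Blk r 2)" using linked_cell(2)[of r V3 "7 + 2 * q + p"] r by simp
  moreover have "linked (Blk r 1) (Blk r 3)" using linked_cell(1)[of r U2 "7 + 2 * q"] r by simp
  moreover have "i = 0 \<or> i = 1 \<or> i = 2 \<or> i = 3" "j = 0 \<or> j = 1 \<or> j = 2 \<or> j = 3" using ij by auto
  ultimately show ?thesis by (elim disjE) simp_all
qed

lemma linked_strips:
  assumes r: "r < s"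
  shows "k < p \<Longrightarrow> j < 2 \<Longrightarrow> linked (cell_label s h r (SU12 k)) (Blk r j)"
    and "k < q \<Longrightarrow> j < 2 \<Longrightarrow> linked (cell_label s h r (SU34 k)) (Blk r (2 + j))"
    and "k < p \<Longrightarrow> j < 2 \<Longrightarrow> linked (Blk r j) (cell_label s h r (SV12 k))"
    and "k < q \<Longrightarrow> j < 2 \<Longrightarrow> linked (Blk r (2 + j)) (cell_label s h r (SV34 k))"
proof -
  have j: "P 0 \<Longrightarrow> P 1 \<Longrightarrow> j < 2 \<Longrightarrow> P j" for P and j :: nat
    by (cases j) (auto simp: less_Suc_eq numeral_2_eq_2)
  note [simp del] = cell_label.simps(15-18)
  show "linked (cell_label s h r (SU12 k)) (Blk r j)" if "k < p" "j < 2"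
  proof (rule j[OF _ _ that(2)])
    show "linked (cell_label s h r (SU12 k)) (Blk r 0)"
      using linked_cell(2)[of r V1 "10 + 2 * q + p + k"] r that by (simp add: W_def)
    show "linked (cell_label s h r (SU12 k)) (Blk r 1)"
      using linked_cell(1)[of r "SU12 k" "10 + 2 * q + p + k"] r that by simp
  qed
  show "linked (cell_label s h r (SU34 k)) (Blk r (2 + j))" if "k < q" "j < 2"
  proof (rule j[OF _ _ that(2)])
    show "linked (cell_label s h r (SU34 k)) (Blk r (2 + 0))"
      using linked_cell(2)[of r V3 "6 + q + k"] r that by simp
    show "linked (cell_label s h r (SU34 k)) (Blk r (2 + 1))"
      using linked_cell(1)[of r "SU34 k" "6 + q + k"] r that by simp
  qed
  show "linked (Blk r j) (cell_label s h r (SV12 k))" if "k < p" "j < 2"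
  proof (rule j[OF _ _ that(2)])
    show "linked (Blk r 0) (cell_label s h r (SV12 k))"
      using linked_cell(1)[of r U1 "7 + 2 * q + k"] r that by simp
    show "linked (Blk r 1) (cell_label s h r (SV12 k))"
      using linked_cell(2)[of r "SV12 k" "7 + 2 * q + k"] r that by simp
  qed
  show "linked (Blk r (2 + j)) (cell_label s h r (SV34 k))" if "k < q" "j < 2"
  proof (rule j[OF _ _ that(2)])
    show "linked (Blk r (2 + 0)) (cell_label s h r (SV34 k))"
      using linked_cell(1)[of r U3 "5 + k"] r that by simp
    show "linked (Blk r (2 + 1)) (cell_label s h r (SV34 k))"
      using linked_cell(2)[of r "SV34 k" "5 + k"] r that by simp
  qed
qed

lemma linked_other_block:
  assumes "r < s" "r' < s" "r \<noteq> r'" "i < 4" "j < 4"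
  shows "linked (Blk r i) (Blk r' j)"
proof -
  have sp: "k < p" "k < q" if "k < 2 * (s - 1)" for k using that less_p less_q by auto
  have U: "cell_label s h r' (SU12 (slot r' r e)) = Blk r e" "cell_label s h r' (SU34 (slot r' r e)) = Blk r (2 + e)"
    if "e < 2" for e
    using slot_less[OF assms(2,1,3) that] other_slot[OF assms(3) that] slot_mod[OF that] by simp_all
  have V: "cell_label s h r (SV12 (slot r r' e)) = Blk r' (2 + e)" "cell_label s h r (SV34 (slot r r' e)) = Blk r' e"
    if "e < 2" for e
    using slot_less[OF assms(1,2) assms(3)[symmetric] that] other_slot[OF assms(3)[symmetric] that] slot_mod[OF that]
    by simp_all
  consider "i < 2" "j < 2" | i' j' where "i = 2 + i'" "i' < 2" "j = 2 + j'" "j' < 2"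
    | j' where "i < 2" "j = 2 + j'" "j' < 2" | i' where "i = 2 + i'" "i' < 2" "j < 2"
    using assms(4,5) by (metis add_less_cancel_left le_add_diff_inverse linorder_not_less numeral_Bit0)
  then show ?thesis
  proof cases
    case 1
    then show ?thesis
      using linked_strips(1)[OF assms(2) sp(1)[OF slot_less[OF assms(2,1,3)]], of i j] U(1)[of i] by simp
  next
    case (2 i' j')
    then show ?thesis
      using linked_strips(2)[OF assms(2) sp(2)[OF slot_less[OF assms(2,1,3)]], of i' j'] U(2)[of i'] by simp
  next
    case (3 j')
    then show ?thesis
      using linked_strips(3)[OF assms(1) sp(1)[OF slot_less[OF assms(1,2) assms(3)[symmetric]]], of j' i] V(1)[of j'] by simp
  next
    case (4 i')
    then show ?thesis
      using linked_strips(4)[OF assms(1) sp(2)[OF slot_less[OF assms(1,2) assms(3)[symmetric]]], of j i'] V(2)[of j] by simp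
  qed
qed

lemma linked_right:
  assumes "cov i (s * W + d)" "i \<noteq> In 0 Top"
  shows "in_upper i \<Longrightarrow> linked (label s h i) (label s h (above_right i d))"
    and "\<not> in_upper i \<Longrightarrow> linked (label s h (above_right i d)) (label s h i)"
  using touches_right[OF assms refl] above_right[OF assms] linked_upper linked_lower by blast+

text \<open>Hub 0 meets the vertices 0 and 1 as \<open>Bot\<close> and \<open>Top\<close>, and 2 and
  3 in the strips \<open>SU34\<close> and \<open>SV34\<close>, or as \<open>HB\<close> and
  \<open>Hb\<close> if \<open>h = 2\<close>. The other hubs meet 0 and 1 in the strips
  \<open>SU12\<close> and \<open>SV12\<close>, and 2 and 3 along \<open>XU\<close> and
  \<open>XV\<close>.\<close>

lemma linked_hub_block:
  assumes x: "x < h" and r: "r < s" and j: "j < 4"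
  shows "linked (Hub x) (Blk r j)" and "linked (Blk r j) (Hub x)"
proof -
  have h3: "h = 1 \<or> h = 2 \<or> h = 3" using x h by linarith
  have frame: "linked (Hub 0) (Blk r 0)" "linked (Hub 0) (Blk r 1)" "linked (Blk r 0) (Hub 0)" "linked (Blk r 1) (Hub 0)"
    using linked_cell(2)[of r Q1 1] linked_cell(2)[of r Q2 2] linked_cell(2)[of r Bot 1] linked_cell(2)[of r Bot 3] r x
    by (simp_all add: W_def)
  have m: "2 * r + e < m" if "2 \<le> h" "e < 2" for e using that r less_m[of "2 * r + e"] by simp
  have lab: "label s h (XU (2 * r + e)) = Blk r (2 + e)" "label s h (XV (2 * r + e)) = Blk r (2 + e)" if "e < 2" for e
    using that by auto
  have XU: "linked (Blk r (2 + e)) (label s h Hb)" "linked (Blk r (2 + e)) (label s h Ha)" if "2 \<le> h" "e < 2" for e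
    using linked_right(2)[of Hb "2 + (2 * r + e)"] linked_right(1)[of "XU (2 * r + e)" "2 + (2 * r + e)"]
      m[OF that] lab[OF that(2)] by (simp_all add: cov_def)
  have XV: "linked (label s h HB) (Blk r (2 + e))" "linked (label s h HA) (Blk r (2 + e))" if "2 \<le> h" "e < 2" for e
    using linked_right(2)[of "XV (2 * r + e)" "3 + m + (2 * r + e)"] linked_right(1)[of HA "3 + m + (2 * r + e)"]
      m[OF that] lab[OF that(2)] by (simp_all add: cov_def)
  have q: "2 * (s - 1) < q" if "h \<noteq> 2" using that h3 less_q[of "2 * (s - 1)"] by auto
  have S34: "linked (Hub 0) (Blk r (2 + e))" "linked (Blk r (2 + e)) (Hub 0)" if "h \<noteq> 2" "e < 2" for e
    using linked_strips(2,4)[OF r q[OF that(1)] that(2)] by simp_all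
  have p: "2 * (s - 1) + (x - 1) < p" if "0 < x" using that x less_p[of "2 * (s - 1) + (x - 1)"] by simp
  have S12: "linked (Hub x) (Blk r e)" "linked (Blk r e) (Hub x)" if "0 < x" "e < 2" for e
  proof -
    have "Suc (x - 1) = x" using that by simp
    then have "cell_label s h r (SU12 (2 * (s - 1) + (x - 1))) = Hub x" "cell_label s h r (SV12 (2 * (s - 1) + (x - 1))) = Hub x"
      by (simp_all only: cell_label.simps not_less le_add1 if_not_P if_False diff_add_inverse plus_1_eq_Suc not_add_less1)
    then show "linked (Hub x) (Blk r e)" "linked (Blk r e) (Hub x)"
      using linked_strips(1,3)[OF r p[OF that(1)] that(2)] by (simp_all only:)
  qed
  have x3: "x = 0 \<or> x = 1 \<or> x = 2" using x h by linarith
  have hx: "x = 0 \<and> h = 2 \<or> x = 0 \<and> h \<noteq> 2 \<or> x = 1 \<and> 2 \<le> h \<or> x = 2 \<and> h = 3" using x h x3 by linarith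
  consider "j = 0 \<or> j = 1" | e where "j = 2 + e" "e < 2"
    using j by (metis One_nat_def add_less_cancel_left le_add_diff_inverse less_2_cases linorder_not_less numeral_Bit0)
  then have "linked (Hub x) (Blk r j) \<and> linked (Blk r j) (Hub x)"
  proof cases
    case 1
    then show ?thesis using frame S12[of j] by (cases "x = 0") auto
  next
    case (2 e)
    then show ?thesis using XU[of e] XV[of e] S34[of e] hx by auto
  qed
  then show "linked (Hub x) (Blk r j)" "linked (Blk r j) (Hub x)" by auto
qed

text \<open>For \<open>h = 3\<close> the bars \<open>HA\<close>, \<open>HB\<close>,
  \<open>Ha\<close>, \<open>Hb\<close>, \<open>Bot\<close> and \<open>Top\<close> miss two of the
  nine edges, those from upper hub 2 to lower hubs 0 and 2. The prolonged strip bar belongs to upper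
  hub 2 and lies between \<open>Bot\<close> and \<open>Hb\<close>, so it shows both.\<close>

lemma linked_hubs:
  assumes x: "x < h" "y < h"
  shows "linked (Hub x) (Hub y)"
proof -
  have 00: "linked (Hub 0) (Hub 0)" using linked_cell(2)[of 0 Bot 0] s x by (simp add: W_def)
  have wide: "linked (label s h HA) (Hub 0)" "linked (label s h HA) (label s h Ha)" "linked (label s h HA) (label s h Hb)"
    "linked (Hub 0) (label s h Ha)" "linked (Hub 0) (label s h Hb)" "linked (label s h HB) (label s h Ha)"
    "linked (label s h (In (s - 1) (SU12 (p - 1)))) (label s h Hb)" "linked (label s h (In (s - 1) (SU12 (p - 1)))) (Hub 0)"
    if h2: "2 \<le> h"
  proof -
    have m: "0 < m" using less_m[of 0] h2 s by simp
    have S: "cov (In (s - 1) (SU12 (p - 1))) (s * W)" using cov_right_In[of "s - 1" "SU12 (p - 1)" 0] m by simp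
    show "linked (label s h HA) (Hub 0)"
      using linked_right(2)[of "In 0 Bot" 1] m h2 s by (simp add: cov_def)
    show "linked (label s h HA) (label s h Ha)"
      using linked_right(1)[of HA "2 + m"] m by (simp add: cov_def)
    show "linked (label s h HA) (label s h Hb)"
      using linked_right(1)[of HA 1] m by (simp add: cov_def)
    show "linked (Hub 0) (label s h Ha)"
      using linked_right(2)[of Ha 2] m h2 by (simp add: cov_def)
    show "linked (Hub 0) (label s h Hb)"
      using linked_right(2)[of Hb 0] m h2 by (simp add: cov_def)
    show "linked (label s h HB) (label s h Ha)"
      using linked_right(1)[of HB "3 + m"] m by (simp add: cov_def)
    show "linked (label s h (In (s - 1) (SU12 (p - 1)))) (label s h Hb)"
      using linked_right(1)[of "In (s - 1) (SU12 (p - 1))" 0] S by (simp del: label.simps(1))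
    show "linked (label s h (In (s - 1) (SU12 (p - 1)))) (Hub 0)"
      using linked_right(2)[of "In 0 Bot" 0] m h2 s by (simp add: cov_def del: label.simps(1)) (simp del: cell_label.simps(15))
  qed
  have S: "label s h (In (s - 1) (SU12 (p - 1))) = Hub 2" if "h = 3"
    using that p_eq by simp
  have "x = 0 \<and> y = 0 \<or> h = 2 \<and> x < 2 \<and> y < 2 \<or> h = 3 \<and> x < 3 \<and> y < 3" using x h by linarith
  then show ?thesis
    using 00 wide S by (auto simp: numeral_2_eq_2 numeral_3_eq_3 less_Suc_eq)
qed

lemma linked_all:
  assumes "u \<in> vtxs s h" "v \<in> vtxs s h"
  shows "linked u v"
  using assms linked_block linked_other_block linked_hub_block linked_hubs
  by (cases u; cases v) (auto, metis)

end

section \<open>The bar visibility number\<close>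

lemma complete_bipartite_sides:
  assumes "K\<^bsub>n,n\<^esub> G"
  obtains U V where "verts G = U \<union> V" "U \<inter> V = {}" "card U = n" "card V = n" "arcs_ends G = U \<times> V \<union> V \<times> U"
    "finite U" "finite V" "symmetric G"
proof -
  interpret graph G using assms by (simp add: complete_bipartite_digraph_def)
  obtain U V where *: "verts G = U \<union> V" "U \<inter> V = {}" "card U = n" "card V = n" "arcs_ends G = U \<times> V \<union> V \<times> U"
    using assms unfolding complete_bipartite_digraph_def by blast
  moreover have "finite U" "finite V" using finite_verts unfolding *(1) by auto
  ultimately show ?thesis using that sym_arcs by blast
qed

lemma rep_blocks:
  assumes K: "K\<^bsub>n,n\<^esub> G" and n: "n = 4 * s + h" "0 < s" "h \<le> 3"
  shows "\<exists>\<beta>. bar_visibility_rep (s + 1) G \<beta>"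
proof -
  obtain U V where UV: "verts G = U \<union> V" "U \<inter> V = {}" "card U = n" "card V = n" "arcs_ends G = U \<times> V \<union> V \<times> U"
    "finite U" "finite V" "symmetric G"
    by (rule complete_bipartite_sides[OF K])
  define p q m where "p = 2 * (s - 1) + (h - 1)" and "q = 2 * (s - 1) + (if h = 1 \<or> h = 3 then 1 else 0)"
    and "m = (if 2 \<le> h then 2 * s else 0)"
  interpret labelled p q s m h
    by unfold_locales (use n in \<open>auto simp: p_def q_def m_def\<close>)
  have fin: "finite (vtxs s h)" by (simp add: vtxs_def)
  obtain f where f: "bij_betw f (vtxs s h) U"
    using finite_same_card_bij[OF fin UV(6)] card_vtxs[of s h] UV(3) n(1) by auto
  obtain g where g: "bij_betw g (vtxs s h) V"
    using finite_same_card_bij[OF fin UV(7)] card_vtxs[of s h] UV(4) n(1) by auto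
  define lab where "lab i = (if in_upper i then f else g) (label s h i)" for i
  have vt: "label s h i \<in> vtxs s h" if "ok i" for i
    using label_vtxs[OF plain_ok[OF that]] n by simp
  have labU: "lab i \<in> U \<longleftrightarrow> in_upper i" "lab i \<in> V \<longleftrightarrow> \<not> in_upper i" if "ok i" for i
  proof -
    have "f (label s h i) \<in> U" "g (label s h i) \<in> V"
      using bij_betwE[OF f] bij_betwE[OF g] vt[OF that] by auto
    then show "lab i \<in> U \<longleftrightarrow> in_upper i" "lab i \<in> V \<longleftrightarrow> \<not> in_upper i"
      using UV(2) unfolding lab_def by auto
  qed
  show ?thesis
  proof (rule columns_rep[of "{i. ok i}" lb rb lev lab])
    fix w assume w: "w \<in> verts G"
    define F c where "F = (if w \<in> U then f else g)" and "c = (w \<in> U)"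
    have "\<exists>v\<in>vtxs s h. F v = w"
      using w UV(1) f g unfolding F_def bij_betw_def by auto
    then obtain v where v: "v \<in> vtxs s h" "F v = w" by blast
    have "label s h i = v \<and> in_upper i = c" if "ok i" "lab i = w" for i
    proof -
      have "in_upper i = c" using labU[OF that(1)] that(2) by (simp add: c_def)
      moreover from this have "F (label s h i) = F v" using that v by (auto simp: lab_def F_def c_def)
      moreover have "inj_on F (vtxs s h)" using f g by (simp add: F_def bij_betw_def)
      ultimately show ?thesis using v vt[OF that(1)] by (auto dest: inj_onD)
    qed
    then have "{i \<in> {i. ok i}. lab i = w} \<subseteq> {i \<in> {i. ok i}. label s h i = v \<and> in_upper i = c}" by blast
    then have "card {i \<in> {i. ok i}. lab i = w} \<le> card {i \<in> {i. ok i}. label s h i = v \<and> in_upper i = c}"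
      by (intro card_mono) (use finite_ok in auto)
    then show "card {i \<in> {i. ok i}. lab i = w} \<le> s + 1" using card_label[of v c] by linarith
  next
    fix i j x
    assume *: "i \<in> {i. ok i}" "j \<in> {i. ok i}" "lab i \<noteq> lab j" "\<not> lab i \<rightarrow>\<^bsub>G\<^esub> lab j"
      "lb i \<le> x" "x < rb i" "lb j \<le> x" "x < rb j" "lev i < lev j"
    have "in_upper i = in_upper j" using labU[of i] labU[of j] * UV(5) by auto
    then have "\<exists>k. cov k x \<and> lev i < lev k \<and> lev k < lev j"
      using * by (intro separated) (auto simp: cov_def)
    then show "\<exists>k\<in>{i. ok i}. lb k \<le> x \<and> x < rb k \<and> lev i < lev k \<and> lev k < lev j"
      by (auto simp: cov_def)
  next
    have main: "\<exists>i\<in>{i. ok i}. \<exists>j\<in>{i. ok i}. {lab i, lab j} = {u, v} \<and> (\<exists>x. lb i \<le> x \<and> x < rb i \<and> lb j \<le> x \<and> x < rb j \<and>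
       lev i < lev j \<and> (\<forall>k\<in>{i. ok i}. lb k \<le> x \<longrightarrow> x < rb k \<longrightarrow> \<not> (lev i < lev k \<and> lev k < lev j)))"
      if uv: "u \<in> U" "v \<in> V" for u v
    proof -
      obtain a b where ab: "a \<in> vtxs s h" "f a = u" "b \<in> vtxs s h" "g b = v"
        using f g uv unfolding bij_betw_def by blast
      obtain i j where ij: "in_upper i" "\<not> in_upper j" "label s h i = a" "label s h j = b" "touches i j \<or> touches j i"
        using linked_all[OF ab(1,3)] unfolding linked_def by blast
      then have l: "lab i = u" "lab j = v" using ab by (simp_all add: lab_def)
      from ij(5) show ?thesis
      proof
        assume "touches i j"
        then obtain x where x: "cov i x" "cov j x" "lev i < lev j" "\<forall>k. cov k x \<longrightarrow> \<not> (lev i < lev k \<and> lev k < lev j)"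
          unfolding touches_def by blast
        show ?thesis
          by (rule bexI[of _ i], rule bexI[of _ j], intro conjI exI[of _ x]) (use x l in \<open>auto simp: cov_def\<close>)
      next
        assume "touches j i"
        then obtain x where x: "cov j x" "cov i x" "lev j < lev i" "\<forall>k. cov k x \<longrightarrow> \<not> (lev j < lev k \<and> lev k < lev i)"
          unfolding touches_def by blast
        show ?thesis
          by (rule bexI[of _ j], rule bexI[of _ i], intro conjI exI[of _ x]) (use x l in \<open>auto simp: cov_def\<close>)
      qed
    qed
    fix u v assume "u \<rightarrow>\<^bsub>G\<^esub> v"
    then consider "u \<in> U" "v \<in> V" | "v \<in> U" "u \<in> V" using UV(5) by auto
    then show "\<exists>i\<in>{i. ok i}. \<exists>j\<in>{i. ok i}. {lab i, lab j} = {u, v} \<and> (\<exists>x. lb i \<le> x \<and> x < rb i \<and> lb j \<le> x \<and> x < rb j \<and>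
       lev i < lev j \<and> (\<forall>k\<in>{i. ok i}. lb k \<le> x \<longrightarrow> x < rb k \<longrightarrow> \<not> (lev i < lev k \<and> lev k < lev j)))"
    proof cases
      case 1
      then show ?thesis by (rule main)
    next
      case 2
      then show ?thesis using main[of v u] by (simp only: insert_commute)
    qed
  next
    fix i assume "i \<in> {i. ok i}"
    then show "lab i \<in> verts G" using labU[of i] UV(1) by auto
  qed (use finite_ok lb_less_rb same_lev UV(8) in auto)
qed

text \<open>One side forms \<open>n\<close> rows of full width, and each of the \<open>t\<close>
  gaps, the one above row \<open>c\<close> for every \<open>c < t\<close>, contains all vertices of
  the other side. This serves the cases without blocks: \<open>n \<le> 2\<close> with
  \<open>t = 1\<close>, and K_{3,3} with \<open>t = 2\<close>.\<close>

lemma rep_rows: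
  assumes K: "K\<^bsub>n,n\<^esub> G" and t: "0 < t" "n \<le> t + 1"
  shows "\<exists>\<beta>. bar_visibility_rep t G \<beta>"
proof -
  obtain U V where UV: "verts G = U \<union> V" "U \<inter> V = {}" "card U = n" "card V = n" "arcs_ends G = U \<times> V \<union> V \<times> U"
    "finite U" "finite V" "symmetric G"
    by (rule complete_bipartite_sides[OF K])
  obtain f where f: "bij_betw f {0..<n} U" using ex_bij_betw_nat_finite[OF UV(6)] UV(3) by auto
  obtain g where g: "bij_betw g {0..<n} V" using ex_bij_betw_nat_finite[OF UV(7)] UV(4) by auto
  have fU: "f i \<in> U" "f i \<notin> V" if "i < n" for i using bij_betwE[OF f] that UV(2) by auto
  have gV: "g i \<in> V" "g i \<notin> U" if "i < n" for i using bij_betwE[OF g] that UV(2) by auto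
  define I :: "(nat + nat \<times> nat) set" where "I = Inl ` {..<n} \<union> Inr ` ({..<t} \<times> {..<n})"
  define l r h :: "nat + nat \<times> nat \<Rightarrow> nat"
    where "l = case_sum (\<lambda>i. 0) snd" and "r = case_sum (\<lambda>i. n) (\<lambda>x. snd x + 1)" and "h = case_sum (\<lambda>i. 2 * i) (\<lambda>x. 2 * fst x + 1)"
  define lab :: "nat + nat \<times> nat \<Rightarrow> 'a" where "lab = case_sum f (\<lambda>x. g (snd x))"
  have simps [simp]: "l (Inl i) = 0" "l (Inr (c, j)) = j" "r (Inl i) = n" "r (Inr (c, j)) = j + 1"
    "h (Inl i) = 2 * i" "h (Inr (c, j)) = 2 * c + 1" "lab (Inl i) = f i" "lab (Inr (c, j)) = g j" for i c j
    by (simp_all add: l_def r_def h_def lab_def)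
  have I [simp]: "Inl i \<in> I \<longleftrightarrow> i < n" "Inr (c, j) \<in> I \<longleftrightarrow> c < t \<and> j < n" for i c j
    by (auto simp: I_def)
  have cases: "(\<exists>i. x = Inl i \<and> i < n) \<or> (\<exists>c j. x = Inr (c, j) \<and> c < t \<and> j < n)" if "x \<in> I" for x
    using that by (auto simp: I_def)
  show ?thesis
  proof (rule columns_rep[of I l r h lab])
    show "finite I" by (simp add: I_def)
    show "l i < r i" if "i \<in> I" for i using cases[OF that] by auto
    show "r i \<le> l j \<or> r j \<le> l i" if "i \<in> I" "j \<in> I" "i \<noteq> j" "h i = h j" for i j
    proof -
      have "2 * a \<noteq> Suc (2 * c)" "Suc (2 * c) \<noteq> 2 * a" for a c :: nat by presburger+
      then show ?thesis
        using cases[OF that(1)] cases[OF that(2)] that(3,4) by (elim disjE exE conjE) auto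
    qed
    show "lab i \<in> verts G" if "i \<in> I" for i using cases[OF that] fU gV UV(1) by auto
    show "symmetric G" by (rule UV)
  next
    fix w assume "w \<in> verts G"
    then consider "w \<in> U" | "w \<in> V" using UV by auto
    then show "card {i \<in> I. lab i = w} \<le> t"
    proof cases
      case 1
      have "\<exists>a. {i \<in> I. lab i = w} \<subseteq> {a}"
      proof -
        obtain a where "a < n" "f a = w" using f 1 unfolding bij_betw_def by fastforce
        moreover have "inj_on f {0..<n}" using f by (simp add: bij_betw_def)
        ultimately have "{i \<in> I. lab i = w} \<subseteq> {Inl a}" using cases gV 1 by (fastforce dest: inj_onD)
        then show ?thesis by blast
      qed
      then obtain a where "{i \<in> I. lab i = w} \<subseteq> {a}" by blast
      then have "card {i \<in> I. lab i = w} \<le> card {a}" by (intro card_mono) auto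
      then show ?thesis using t by simp
    next
      case 2
      obtain a where a: "a < n" "g a = w" using g 2 unfolding bij_betw_def by fastforce
      moreover have "inj_on g {0..<n}" using g by (simp add: bij_betw_def)
      ultimately have "{i \<in> I. lab i = w} \<subseteq> (\<lambda>c. Inr (c, a)) ` {..<t}" using cases fU 2 by (fastforce dest: inj_onD)
      then have "card {i \<in> I. lab i = w} \<le> card ((\<lambda>c. Inr (c, a) :: nat + nat \<times> nat) ` {..<t})"
        by (intro card_mono) auto
      also have "\<dots> \<le> t" using card_image_le[of "{..<t}"] by simp
      finally show ?thesis .
    qed
  next
    fix i j x
    assume *: "i \<in> I" "j \<in> I" "lab i \<noteq> lab j" "\<not> lab i \<rightarrow>\<^bsub>G\<^esub> lab j" "l i \<le> x" "x < r i" "l j \<le> x" "x < r j" "h i < h j"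
    show "\<exists>k\<in>I. l k \<le> x \<and> x < r k \<and> h i < h k \<and> h k < h j"
    proof (cases i)
      case (Inl a)
      then have a: "a < n" using *(1) by simp
      show ?thesis
      proof (cases j)
        case (Inl b)
        then have "b < n" "a < b" "x < n" using * \<open>i = Inl a\<close> by simp_all
        then show ?thesis using Inl \<open>i = Inl a\<close> t by (intro bexI[of _ "Inr (a, x)"]) auto
      next
        case (Inr b)
        then show ?thesis using * \<open>i = Inl a\<close> fU gV UV(5) by (cases b) auto
      qed
    next
      case (Inr a)
      show ?thesis
      proof (cases j)
        case (Inl b)
        then show ?thesis using * \<open>i = Inr a\<close> fU gV UV(5) by (cases a) auto
      next
        case (Inr b)
        then have "snd a = x" "snd b = x" using * \<open>i = Inr a\<close> by (cases a; cases b; simp)+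
        then show ?thesis using * Inr \<open>i = Inr a\<close> by (cases a; cases b) simp
      qed
    qed
  next
    have main: "\<exists>i\<in>I. \<exists>j\<in>I. {lab i, lab j} = {u, v} \<and> (\<exists>x. l i \<le> x \<and> x < r i \<and> l j \<le> x \<and> x < r j \<and> h i < h j \<and>
        (\<forall>k\<in>I. l k \<le> x \<longrightarrow> x < r k \<longrightarrow> \<not> (h i < h k \<and> h k < h j)))" if uv: "u \<in> U" "v \<in> V" for u v
    proof -
      obtain i where i: "i < n" "f i = u" using f uv unfolding bij_betw_def by fastforce
      obtain j where j: "j < n" "g j = v" using g uv unfolding bij_betw_def by fastforce
      show ?thesis
      \<comment> \<open>Row \<open>i\<close> uses the gap above it; only the last row can have
        \<open>i = t\<close>, and it uses the gap below.\<close>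
      proof (cases "i < t")
        case True
        show ?thesis
          by (rule bexI[of _ "Inl i"], rule bexI[of _ "Inr (i, j)"], intro conjI exI[of _ j]) (use True i j in auto)
      next
        case False
        show ?thesis
          by (rule bexI[of _ "Inr (i - 1, j)"], rule bexI[of _ "Inl i"], intro conjI exI[of _ j])
            (use False i j t in auto)
      qed
    qed
    fix u v assume "u \<rightarrow>\<^bsub>G\<^esub> v"
    then consider "u \<in> U" "v \<in> V" | "v \<in> U" "u \<in> V" using UV(5) by auto
    then show "\<exists>i\<in>I. \<exists>j\<in>I. {lab i, lab j} = {u, v} \<and> (\<exists>x. l i \<le> x \<and> x < r i \<and> l j \<le> x \<and> x < r j \<and> h i < h j \<and>
        (\<forall>k\<in>I. l k \<le> x \<longrightarrow> x < r k \<longrightarrow> \<not> (h i < h k \<and> h k < h j)))"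
    proof cases
      case 1
      then show ?thesis by (rule main)
    next
      case 2
      then show ?thesis using main[of v u] by (simp only: insert_commute)
    qed
  qed
qed

lemma bar_visibility_number_eqI:
  assumes "\<exists>\<beta>. bar_visibility_rep t G \<beta>" "\<And>t' \<beta>. bar_visibility_rep t' G \<beta> \<Longrightarrow> t \<le> t'"
  shows "bar_visibility_number G = t"
  unfolding bar_visibility_number_def by (rule Least_equality) (use assms in auto)

theorem theorem5:
  shows "(\<forall>(n::nat) (G :: ('a, 'b) pre_digraph). 0 < n \<and> n \<noteq> 3 \<and> K\<^bsub>n,n\<^esub> G \<longrightarrow>
            int (bar_visibility_number G) = \<lceil>(real n + 1) / 4\<rceil>) \<and>
         (\<forall>G :: ('a, 'b) pre_digraph. K\<^bsub>3,3\<^esub> G \<longrightarrow> bar_visibility_number G = 2)"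
proof (intro conjI allI impI)
  fix n :: nat and G :: "('a, 'b) pre_digraph"
  assume n: "0 < n \<and> n \<noteq> 3 \<and> K\<^bsub>n,n\<^esub> G"
  define s where "s = n div 4"
  have s: "4 * s \<le> n" "n \<le> 4 * s + 3" by (simp_all add: s_def)
  have "\<exists>\<beta>. bar_visibility_rep (s + 1) G \<beta>"
  proof (cases "s = 0")
    case True
    \<comment> \<open>Here \<open>n\<close> is 1 or 2, as 3 is excluded.\<close>
    then show ?thesis using n s rep_rows[of n G 1] by auto
  next
    case False
    then show ?thesis using n s rep_blocks[of n G s "n - 4 * s"] by auto
  qed
  then have "bar_visibility_number G = s + 1"
  proof (rule bar_visibility_number_eqI)
    fix t' and \<beta> :: "'a \<Rightarrow> (real \<times> real) set set"
    assume "bar_visibility_rep t' G \<beta>"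
    then have "n < 4 * t'" using rep_complete_bipartite_lower_bound(1) n by blast
    then show "s + 1 \<le> t'" using s by simp
  qed
  \<comment> \<open>From \<open>4 * s \<le> n \<le> 4 * s + 3\<close> the quotient lies above
    \<open>s\<close> and is at most \<open>s + 1\<close>.\<close>
  moreover have "\<lceil>(real n + 1) / 4\<rceil> = int s + 1"
  proof (rule ceiling_unique)
    have "real (4 * s) \<le> real n" "real n \<le> real (4 * s + 3)" using s by (simp_all only: of_nat_le_iff)
    then show "real_of_int (int s + 1) - 1 < (real n + 1) / 4" "(real n + 1) / 4 \<le> real_of_int (int s + 1)"
      by simp_all
  qed
  ultimately show "int (bar_visibility_number G) = \<lceil>(real n + 1) / 4\<rceil>" by simp
next
  fix G :: "('a, 'b) pre_digraph" assume K: "K\<^bsub>3,3\<^esub> G"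
  show "bar_visibility_number G = 2"
  proof (rule bar_visibility_number_eqI)
    show "\<exists>\<beta>. bar_visibility_rep 2 G \<beta>" by (rule rep_rows[OF K]) simp_all
    show "2 \<le> t'" if "bar_visibility_rep t' G \<beta>" for t' \<beta>
      using rep_complete_bipartite_lower_bound(2)[OF K that] by simp
  qed
qed

end
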